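(* Let $m\ge1$ and consider the hyperbolic system $\partial_t q+\partial_x f(q)=0$, $q:\mathbb R_0^+\times\mathbb R\to\mathbb R^m$, with smooth flux $f:\mathbb R^m\to\mathbb R^m$ and Jacobian $J(q)=\nabla_q f(q)=R(q)^{-1}\,\mathrm{diag}(\lambda_1(q),\ldots,\lambda_m(q))\,R(q)$, where $R(q)$ is invertible and $R$ and all (real) eigenvalues $\lambda_i$ depend smoothly on $q$. Let $q_0=(q_{1,0},\ldots,q_{m,0})$ be smooth initial data for which a smooth solution $q$ exists for small times. Fix $x\in\mathbb R$. For $i=1,\ldots,m$ define the predictor $q^{(i)}\in\mathbb R^m$ by $$q^{(i)}_\beta:=\sum_{k,\alpha=1}^m F^{(k)}_{\beta\alpha}(x)\,q_{\alpha,0}\!\left(x-t\,\frac{\lambda_i(x)+\lambda_k(x)}{2}\right),\qquad \beta=1,\ldots,m,$$ where $\lambda_i(x):=\lambda_i(q_0(x))$ and $F^{(k)}(x):=F^{(k)}(q_0(x))$. Set $$\lambda_i^*:=\lambda_i(q^{(i)}),\qquad R^*_{ij}:=R_{ij}(q^{(i)}),\qquad i,j=1,\ldots,m$$ (so the $i$-th row of $R^*$ is evaluated at the $i$-th predictor value). Then the approximate solution operator $$\tilde q_\ell(t,x):=\sum_{i=1}^m (R^* )^{-1}_{\ell i}\sum_{j=1}^m R^*_{ij}\,q_{j,0}(x-\lambda_i^*t)$$ approximates the exact solution as $$\tilde q_\ell(t,x)=q_\ell(t,x)+\mathcal O(t^3)\qquad (t\to0^+),\quad \ell=1,\ldots,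m.$$
   Context: For $k=1,\ldots,m$, $F^{(k)}(q):=R(q)^{-1}\,\mathrm{diag}(0,\ldots,0,1,0,\ldots,0)\,R(q)$ with the entry $1$ in position $k$; this is the projector associated with the $k$-th eigenvalue. The $i$-th component of a vector $q$ is $q_i$, and $R_{ij}$ is the entry of $R$ in row $i$ and column $j$. $(R^* )^{-1}_{\ell i}$ is the $(\ell,i)$ entry of the inverse of $R^*$, which exists for all sufficiently small $t$. *)

theory Defs
  imports "HOL-Analysis.Analysis" "HOL-Library.Landau_Symbols"
begin

text \<open>
  Derivatives are taken within \<open>S\<close>, so that on a half-open time strip \<open>{0..<T} \<times> UNIV\<close> smoothness
  means smoothness up to the boundary \<open>t = 0\<close>, with one-sided time derivatives there. The witness
  \<open>f'\<close> is unique for \<open>S\<close> open, and for \<open>S\<close> convex with nonempty interior; these are the only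
  cases used.
\<close>

primrec Ck_on :: "nat \<Rightarrow> 'a::euclidean_space set \<Rightarrow> ('a \<Rightarrow> 'b::real_normed_vector) \<Rightarrow> bool" where
  "Ck_on 0 S f \<longleftrightarrow> continuous_on S f"
| "Ck_on (Suc n) S f \<longleftrightarrow>
    (\<exists>f'. (\<forall>x\<in>S. (f has_derivative f' x) (at x within S)) \<and> (\<forall>v. Ck_on n S (\<lambda>x. f' x v)))"

definition smooth_on :: "'a::euclidean_space set \<Rightarrow> ('a \<Rightarrow> 'b::real_normed_vector) \<Rightarrow> bool" where
  "smooth_on S f \<longleftrightarrow> (\<forall>n. Ck_on n S f)"

definition diagonal :: "('m \<Rightarrow> real) \<Rightarrow> real ^ 'm ^ 'm" where
  "diagonal d = (\<chi> i j. if i = j then d i else 0)"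

definition smooth_solution ::
    "(real ^ 'm \<Rightarrow> real ^ 'm) \<Rightarrow> (real \<Rightarrow> real ^ 'm) \<Rightarrow> real \<Rightarrow> (real \<Rightarrow> real \<Rightarrow> real ^ 'm) \<Rightarrow> bool" where
  "smooth_solution f q0 T q \<longleftrightarrow>
     smooth_on ({0..<T} \<times> UNIV) (\<lambda>(t, x). q t x) \<and>
     (\<forall>x. q 0 x = q0 x) \<and>
     (\<forall>t\<in>{0..<T}. \<forall>x.
        vector_derivative (\<lambda>s. q s x) (at t within {0..<T})
          + vector_derivative (\<lambda>y. f (q t y)) (at x) = 0)"

definition eigen_proj :: "(real ^ 'm \<Rightarrow> real ^ 'm ^ 'm) \<Rightarrow> 'm \<Rightarrow> real ^ 'm \<Rightarrow> real ^ 'm ^ 'm" where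
  "eigen_proj R k u = matrix_inv (R u) ** diagonal (\<lambda>j. if j = k then 1 else 0) ** R u"

definition predictor ::
    "(real ^ 'm \<Rightarrow> real ^ 'm ^ 'm) \<Rightarrow> ('m \<Rightarrow> real ^ 'm \<Rightarrow> real) \<Rightarrow> (real \<Rightarrow> real ^ 'm)
      \<Rightarrow> real \<Rightarrow> real \<Rightarrow> 'm \<Rightarrow> real ^ 'm" where
  "predictor R lam q0 t x i =
     (\<chi> \<beta>. \<Sum>k\<in>UNIV. \<Sum>\<alpha>\<in>UNIV.
        eigen_proj R k (q0 x) $ \<beta> $ \<alpha> * q0 (x - t * ((lam i (q0 x) + lam k (q0 x)) / 2)) $ \<alpha>)"

definition lam_star ::
    "(real ^ 'm \<Rightarrow> real ^ 'm ^ 'm) \<Rightarrow> ('m \<Rightarrow> real ^ 'm \<Rightarrow> real) \<Rightarrow> (real \<Rightarrow> real ^ 'm)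
      \<Rightarrow> real \<Rightarrow> real \<Rightarrow> 'm \<Rightarrow> real" where
  "lam_star R lam q0 t x i = lam i (predictor R lam q0 t x i)"

definition R_star ::
    "(real ^ 'm \<Rightarrow> real ^ 'm ^ 'm) \<Rightarrow> ('m \<Rightarrow> real ^ 'm \<Rightarrow> real) \<Rightarrow> (real \<Rightarrow> real ^ 'm)
      \<Rightarrow> real \<Rightarrow> real \<Rightarrow> real ^ 'm ^ 'm" where
  "R_star R lam q0 t x = (\<chi> i j. R (predictor R lam q0 t x i) $ i $ j)"

definition approx_solution ::
    "(real ^ 'm \<Rightarrow> real ^ 'm ^ 'm) \<Rightarrow> ('m \<Rightarrow> real ^ 'm \<Rightarrow> real) \<Rightarrow> (real \<Rightarrow> real ^ 'm)
      \<Rightarrow> real \<Rightarrow> real \<Rightarrow> real ^ 'm" where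
  "approx_solution R lam q0 t x =
     (\<chi> l. \<Sum>i\<in>UNIV. matrix_inv (R_star R lam q0 t x) $ l $ i *
        (\<Sum>j\<in>UNIV. R_star R lam q0 t x $ i $ j * q0 (x - lam_star R lam q0 t x i * t) $ j))"

end

theory Submission
  imports Defs
begin

text \<open>
  Write \<open>u = q0 x\<close>, \<open>v = q0' x\<close>, \<open>w = q0'' x\<close>, let \<open>J\<close> be the Jacobian of the flux and let \<open>r\<close> be the
  \<open>i\<close>-th row of \<open>R\<close>, so that \<open>r \<bullet> J z = \<lambda> (r \<bullet> z)\<close> with \<open>\<lambda> = lam i\<close>: the rows of \<open>R\<close> are left
  eigenvectors of \<open>J\<close>. Multiplying the error by \<open>R\<^sup>*\<close> decouples it. The \<open>i\<close>-th component becomes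
  \<open>- r\<^sup>* \<bullet> (q t x - q0 (x - \<lambda>\<^sup>* t))\<close>, where \<open>r\<^sup>*\<close> and \<open>\<lambda>\<^sup>*\<close> are evaluated at the \<open>i\<close>-th predictor. As
  \<open>R\<^sup>*\<close> tends to the invertible matrix \<open>R u\<close>, it suffices that each of these residuals is \<open>O(t\<^sup>3)\<close>.

  Three expansions enter. The equation, differentiated once in \<open>t\<close>, gives
  \<open>q t x = u - t J v + t\<^sup>2/2 (J (J w + D\<^sub>v J v) + D\<^bsub>J v\<^esub> J v) + O(t\<^sup>3)\<close>; here \<open>q\<^sub>x\<^sub>t = q\<^sub>t\<^sub>x\<close> is needed at the boundary
  \<open>t = 0\<close> of the strip. Since the eigenprojectors sum to the identity, and to \<open>J\<close> when weighted by the
  eigenvalues, the predictor is \<open>u + t p + O(t\<^sup>2)\<close> with \<open>p = - (\<lambda> v + J v) / 2\<close>. Finally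
  \<open>q0 (x - \<lambda>\<^sup>* t)\<close> is expanded with \<open>\<lambda>\<^sup>* = \<lambda> + t D\<^sub>p \<lambda> + O(t\<^sup>2)\<close>.

  In the residual the coefficient of \<open>t\<close> is \<open>r \<bullet> (\<lambda> - J) v = 0\<close>. The coefficient of \<open>t\<^sup>2\<close> is
  \<open>D\<^sub>p r \<bullet> (\<lambda> - J) v + (D\<^sub>p \<lambda>) (r \<bullet> v) + (\<lambda> (r \<bullet> D\<^sub>v J v) + r \<bullet> D\<^bsub>J v\<^esub> J v) / 2\<close>, in which \<open>w\<close> has dropped out
  because \<open>r J\<^sup>2 = \<lambda>\<^sup>2 r\<close>. Differentiating the eigenvector relation in the direction \<open>p\<close> turns the first
  two terms into \<open>r \<bullet> D\<^sub>p J v\<close>. In this notation \<open>D\<^sub>h J v\<close> is the second derivative of the flux in the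
  directions \<open>h\<close> and \<open>v\<close>, linear in \<open>h\<close>; the choice of \<open>p\<close> is exactly the one that makes the sum vanish.
  This cancellation is carried out in \<open>row_residual_vanishes\<close>.
\<close>

section \<open>Functions vanishing to a given order at a point\<close>

text \<open>
  The Landau statement \<open>g = O(\<bar>y - a\<bar>\<^sup>n)\<close> for vector-valued \<open>g\<close>, relative to \<open>S\<close> so that
  \<open>S = {0..<T}\<close> gives one-sided expansions in time. The filter is \<open>nhds a\<close> and not \<open>at a\<close>: bounds have
  to hold at \<open>a\<close> itself, since segments issuing from \<open>a\<close> are used to integrate them, and since a
  curve composed with \<open>g\<close> may pass through \<open>a\<close>.
\<close>

definition vanishes ::
    "nat \<Rightarrow> 'a::real_normed_vector set \<Rightarrow> 'a \<Rightarrow> ('a \<Rightarrow> 'b::real_normed_vector) \<Rightarrow> bool" where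
  "vanishes n S a g \<longleftrightarrow> (\<exists>C. \<forall>\<^sub>F y in nhds a. y \<in> S \<longrightarrow> norm (g y) \<le> C * norm (y - a) ^ n)"

lemma vanishesI:
  assumes "\<forall>\<^sub>F y in nhds a. y \<in> S \<longrightarrow> norm (g y) \<le> C * norm (y - a) ^ n"
  shows "vanishes n S a g"
  using assms unfolding vanishes_def by blast

lemma vanishesE:
  assumes "vanishes n S a g"
  obtains C where "C \<ge> 0" "\<forall>\<^sub>F y in nhds a. y \<in> S \<longrightarrow> norm (g y) \<le> C * norm (y - a) ^ n"
proof -
  obtain C where C: "\<forall>\<^sub>F y in nhds a. y \<in> S \<longrightarrow> norm (g y) \<le> C * norm (y - a) ^ n"
    using assms unfolding vanishes_def by blast
  have "\<forall>\<^sub>F y in nhds a. y \<in> S \<longrightarrow> norm (g y) \<le> \<bar>C\<bar> * norm (y - a) ^ n"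
    using C
  proof (rule eventually_mono, intro impI)
    fix y assume "y \<in> S \<longrightarrow> norm (g y) \<le> C * norm (y - a) ^ n" "y \<in> S"
    moreover have "C * norm (y - a) ^ n \<le> \<bar>C\<bar> * norm (y - a) ^ n"
      by (intro mult_right_mono) auto
    ultimately show "norm (g y) \<le> \<bar>C\<bar> * norm (y - a) ^ n" by linarith
  qed
  then show ?thesis using that[of "\<bar>C\<bar>"] by simp
qed

lemma vanishes_cong:
  assumes "vanishes n S a g" "\<And>y. y \<in> S \<Longrightarrow> g y = h y"
  shows "vanishes n S a h"
proof -
  obtain C where C: "C \<ge> 0" "\<forall>\<^sub>F y in nhds a. y \<in> S \<longrightarrow> norm (g y) \<le> C * norm (y - a) ^ n"
    using assms(1) by (rule vanishesE)
  show ?thesis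
    by (rule vanishesI[where C = C], use C(2) in eventually_elim) (simp add: assms(2)[symmetric])
qed

lemma vanishes_zero [simp]: "vanishes n S a (\<lambda>y. 0)"
  by (rule vanishesI[where C = 0]) simp

lemma vanishes_add:
  assumes "vanishes n S a g" "vanishes n S a h"
  shows "vanishes n S a (\<lambda>y. g y + h y)"
proof -
  obtain C where C: "C \<ge> 0" "\<forall>\<^sub>F y in nhds a. y \<in> S \<longrightarrow> norm (g y) \<le> C * norm (y - a) ^ n"
    using assms(1) by (rule vanishesE)
  obtain D where D: "D \<ge> 0" "\<forall>\<^sub>F y in nhds a. y \<in> S \<longrightarrow> norm (h y) \<le> D * norm (y - a) ^ n"
    using assms(2) by (rule vanishesE)
  show ?thesis
  proof (rule vanishesI[where C = "C + D"], use C(2) D(2) in eventually_elim, intro impI)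
    fix y
    assume "y \<in> S \<longrightarrow> norm (g y) \<le> C * norm (y - a) ^ n"
      "y \<in> S \<longrightarrow> norm (h y) \<le> D * norm (y - a) ^ n" "y \<in> S"
    then show "norm (g y + h y) \<le> (C + D) * norm (y - a) ^ n"
      using norm_triangle_ineq[of "g y" "h y"] by (simp add: distrib_right)
  qed
qed

lemma vanishes_bounded_linear:
  assumes "bounded_linear L" "vanishes n S a g"
  shows "vanishes n S a (\<lambda>y. L (g y))"
proof -
  obtain C where "C \<ge> 0" and C: "\<forall>\<^sub>F y in nhds a. y \<in> S \<longrightarrow> norm (g y) \<le> C * norm (y - a) ^ n"
    using assms(2) by (rule vanishesE)
  obtain K where K: "K \<ge> 0" "\<And>z. norm (L z) \<le> norm z * K"
    using bounded_linear.nonneg_bounded[OF assms(1)] by blast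
  show ?thesis
  proof (rule vanishesI[where C = "C * K"], use C in eventually_elim, intro impI)
    fix y assume "y \<in> S \<longrightarrow> norm (g y) \<le> C * norm (y - a) ^ n" "y \<in> S"
    then have "norm (g y) * K \<le> C * norm (y - a) ^ n * K"
      using K(1) by (simp add: mult_right_mono)
    then show "norm (L (g y)) \<le> C * K * norm (y - a) ^ n"
      using K(2)[of "g y"] by (simp add: mult_ac)
  qed
qed

lemma vanishes_minus:
  "vanishes n S a g \<Longrightarrow> vanishes n S a (\<lambda>y. - g y)"
  by (rule vanishes_bounded_linear[OF bounded_linear_minus[OF bounded_linear_ident]])

lemma vanishes_diff:
  assumes "vanishes n S a g" "vanishes n S a h"
  shows "vanishes n S a (\<lambda>y. g y - h y)"
  using vanishes_add[OF assms(1) vanishes_minus[OF assms(2)]] by simp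

lemma vanishes_sum:
  assumes "\<And>i. i \<in> I \<Longrightarrow> vanishes n S a (g i)"
  shows "vanishes n S a (\<lambda>y. \<Sum>i\<in>I. g i y)"
  using assms by (induction I rule: infinite_finite_induct) (auto intro: vanishes_add)

lemma vanishes_mono:
  assumes "vanishes n S a g" "m \<le> n"
  shows "vanishes m S a g"
proof -
  obtain C where C: "C \<ge> 0" "\<forall>\<^sub>F y in nhds a. y \<in> S \<longrightarrow> norm (g y) \<le> C * norm (y - a) ^ n"
    using assms(1) by (rule vanishesE)
  have near: "\<forall>\<^sub>F y in nhds a. dist y a < 1"
    unfolding eventually_nhds_metric by (auto intro: exI[of _ 1])
  show ?thesis
  proof (rule vanishesI[where C = C], use C(2) near in eventually_elim, intro impI)
    fix y assume y: "y \<in> S \<longrightarrow> norm (g y) \<le> C * norm (y - a) ^ n" "dist y a < 1" "y \<in> S"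
    then have "norm (y - a) ^ n \<le> norm (y - a) ^ m"
      using assms(2) by (intro power_decreasing) (auto simp: dist_norm)
    then have "C * norm (y - a) ^ n \<le> C * norm (y - a) ^ m"
      using C(1) by (intro mult_left_mono)
    then show "norm (g y) \<le> C * norm (y - a) ^ m" using y by linarith
  qed
qed

lemma vanishes_bilinear:
  assumes "bounded_bilinear pr" "vanishes m S a g" "vanishes n S a h"
  shows "vanishes (m + n) S a (\<lambda>y. pr (g y) (h y))"
proof -
  obtain C where C: "C \<ge> 0" "\<forall>\<^sub>F y in nhds a. y \<in> S \<longrightarrow> norm (g y) \<le> C * norm (y - a) ^ m"
    using assms(2) by (rule vanishesE)
  obtain D where D: "D \<ge> 0" "\<forall>\<^sub>F y in nhds a. y \<in> S \<longrightarrow> norm (h y) \<le> D * norm (y - a) ^ n"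
    using assms(3) by (rule vanishesE)
  obtain K where K: "K \<ge> 0" "\<And>z w. norm (pr z w) \<le> norm z * norm w * K"
    using bounded_bilinear.nonneg_bounded[OF assms(1)] by blast
  show ?thesis
  proof (rule vanishesI[where C = "C * D * K"], use C(2) D(2) in eventually_elim, intro impI)
    fix y
    assume "y \<in> S \<longrightarrow> norm (g y) \<le> C * norm (y - a) ^ m"
      "y \<in> S \<longrightarrow> norm (h y) \<le> D * norm (y - a) ^ n" "y \<in> S"
    then have "norm (g y) * norm (h y) \<le> (C * norm (y - a) ^ m) * (D * norm (y - a) ^ n)"
      using C(1) by (intro mult_mono) auto
    then have "norm (g y) * norm (h y) * K \<le> (C * norm (y - a) ^ m) * (D * norm (y - a) ^ n) * K"
      using K(1) by (rule mult_right_mono)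
    then show "norm (pr (g y) (h y)) \<le> C * D * K * norm (y - a) ^ (m + n)"
      using K(2)[of "g y" "h y"] by (simp add: mult_ac power_add)
  qed
qed

lemma vanishes_const: "vanishes 0 S a (\<lambda>y. c)"
  by (rule vanishesI[where C = "norm c"]) simp

lemma vanishes_power: "vanishes n S (0::real) (\<lambda>t. t ^ n)"
  by (rule vanishesI[where C = 1]) (simp add: power_abs)

lemma vanishes_power_scaleR: "vanishes n S (0::real) (\<lambda>t. t ^ n *\<^sub>R c)"
  using vanishes_bilinear[OF bounded_bilinear_scaleR vanishes_power vanishes_const] by simp

lemma vanishes_has_derivative:
  assumes "(f has_derivative D) (at a within S)"
  shows "vanishes 1 S a (\<lambda>y. f y - f a)"
proof -
  have D: "bounded_linear D" using assms by (rule has_derivative_bounded_linear)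
  obtain d where d: "d > 0" "\<And>y. y \<in> S \<Longrightarrow> norm (y - a) < d \<Longrightarrow>
      norm (f y - f a - D (y - a)) \<le> 1 * norm (y - a)"
    using assms unfolding has_derivative_within_alt by (metis zero_less_one)
  obtain K where K: "\<And>z. norm (D z) \<le> norm z * K"
    using bounded_linear.nonneg_bounded[OF D] by blast
  show ?thesis
  proof (rule vanishesI[where C = "1 + K"])
    have "norm (f y - f a) \<le> (1 + K) * norm (y - a) ^ 1" if "y \<in> S" "dist y a < d" for y
    proof -
      have "norm (f y - f a) \<le> norm (f y - f a - D (y - a)) + norm (D (y - a))"
        using norm_triangle_ineq[of "f y - f a - D (y - a)" "D (y - a)"] by simp
      also have "\<dots> \<le> 1 * norm (y - a) + norm (y - a) * K"
        using d(2)[of y] K[of "y - a"] that by (intro add_mono) (auto simp: dist_norm)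
      finally show ?thesis by (simp add: algebra_simps)
    qed
    then show "\<forall>\<^sub>F y in nhds a. y \<in> S \<longrightarrow> norm (f y - f a) \<le> (1 + K) * norm (y - a) ^ 1"
      unfolding eventually_nhds_metric using d(1) by blast
  qed
qed

lemma vanishes_compose:
  assumes "vanishes n UNIV b h" "vanishes 1 S a (\<lambda>t. c t - b)"
  shows "vanishes n S a (\<lambda>t. h (c t))"
proof -
  obtain C where C: "C \<ge> 0" "\<forall>\<^sub>F y in nhds b. norm (h y) \<le> C * norm (y - b) ^ n"
    using vanishesE[OF assms(1)] by auto
  obtain D where D: "D \<ge> 0" "\<forall>\<^sub>F t in nhds a. t \<in> S \<longrightarrow> norm (c t - b) \<le> D * norm (t - a)"
    using vanishesE[OF assms(2)] by auto
  obtain e where e: "e > 0" "\<And>y. dist y b < e \<Longrightarrow> norm (h y) \<le> C * norm (y - b) ^ n"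
    using C(2) unfolding eventually_nhds_metric by blast
  \<comment> \<open>the denominator is \<open>D + 1\<close> because \<open>D\<close> may be zero\<close>
  have near: "\<forall>\<^sub>F t in nhds a. dist t a < e / (D + 1)"
    unfolding eventually_nhds_metric using e(1) D(1) by (auto intro!: exI[of _ "e / (D + 1)"])
  show ?thesis
  proof (rule vanishesI[where C = "C * D ^ n"], use D(2) near in eventually_elim, intro impI)
    fix t assume "t \<in> S \<longrightarrow> norm (c t - b) \<le> D * norm (t - a)" "dist t a < e / (D + 1)" "t \<in> S"
    then have t: "norm (c t - b) \<le> D * norm (t - a)" and "norm (t - a) < e / (D + 1)"
      by (simp_all add: dist_norm)
    then have "(D + 1) * norm (t - a) < e"
      using D(1) by (simp add: pos_less_divide_eq mult.commute)
    moreover have "D * norm (t - a) \<le> (D + 1) * norm (t - a)"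
      by (intro mult_right_mono) auto
    ultimately have "D * norm (t - a) < e" by linarith
    then have "norm (h (c t)) \<le> C * norm (c t - b) ^ n"
      using e(2)[of "c t"] t by (simp add: dist_norm)
    also have "\<dots> \<le> C * (D * norm (t - a)) ^ n"
      using t C(1) by (intro mult_left_mono power_mono) auto
    finally show "norm (h (c t)) \<le> C * D ^ n * norm (t - a) ^ n"
      by (simp add: power_mult_distrib mult_ac)
  qed
qed

lemma vanishes_imp_bigo_at_right:
  fixes g :: "real \<Rightarrow> real"
  assumes "vanishes n {0..<T} 0 g" "T > 0"
  shows "g \<in> O[at_right 0](\<lambda>t. t ^ n)"
proof -
  obtain C where "C \<ge> 0" and C: "\<forall>\<^sub>F t in nhds 0. t \<in> {0..<T} \<longrightarrow> norm (g t) \<le> C * norm (t - 0) ^ n"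
    using assms(1) by (rule vanishesE)
  then have "\<forall>\<^sub>F t in at_right 0. t \<in> {0..<T} \<longrightarrow> norm (g t) \<le> C * norm (t - 0) ^ n"
    unfolding at_within_def eventually_inf_principal by eventually_elim auto
  moreover have "\<forall>\<^sub>F t in at_right 0. t \<in> {0<..<T}"
    using eventually_at_right_real[OF assms(2)] by simp
  ultimately have "\<forall>\<^sub>F t in at_right 0. norm (g t) \<le> C * norm (t ^ n)"
    by eventually_elim (auto simp: power_abs)
  then show ?thesis by (rule bigoI)
qed

lemma vanishes_imp_tendsto_at_right:
  assumes "vanishes 1 {0..<T} (0::real) (\<lambda>t. g t - L)" "T > 0"
  shows "(g \<longlongrightarrow> L) (at_right 0)"
proof -
  obtain C where "C \<ge> 0" and C: "\<forall>\<^sub>F t in nhds 0. t \<in> {0..<T} \<longrightarrow> norm (g t - L) \<le> C * norm (t - 0) ^ 1"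
    using assms(1) by (rule vanishesE)
  then have "\<forall>\<^sub>F t in at_right 0. t \<in> {0..<T} \<longrightarrow> norm (g t - L) \<le> C * norm (t - 0) ^ 1"
    unfolding at_within_def eventually_inf_principal by eventually_elim auto
  moreover have "\<forall>\<^sub>F t in at_right 0. t \<in> {0<..<T}"
    using eventually_at_right_real[OF assms(2)] by simp
  ultimately have "\<forall>\<^sub>F t in at_right 0. norm (g t - L) \<le> C * t"
    by eventually_elim auto
  moreover have "((\<lambda>t. C * t) \<longlongrightarrow> 0) (at_right (0::real))"
    by (auto intro!: tendsto_eq_intros)
  ultimately have "((\<lambda>t. g t - L) \<longlongrightarrow> 0) (at_right 0)"
    by (rule Lim_null_comparison)
  then show ?thesis by (rule LIM_zero_cancel)
qed

section \<open>Taylor expansions\<close>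

text \<open>
  Integration raises the order by one. On the part of \<open>S\<close> in the ball around \<open>a\<close> through \<open>y\<close> the derivative is at most
  \<open>K \<bar>y - a\<bar>\<^sup>n\<close>, and the mean value inequality there contributes one more factor \<open>\<bar>y - a\<bar>\<close>. Bounds
  on basis vectors suffice because the space is finite-dimensional. Both Taylor formulas below follow
  by applying this to the remainder; the base case is that a differentiable function is Lipschitz at
  the point.
\<close>

lemma vanishes_integrate:
  fixes g :: "'a::euclidean_space \<Rightarrow> 'b::real_normed_vector"
  assumes S: "convex S" "a \<in> S"
    and g: "\<And>y. y \<in> S \<Longrightarrow> (g has_derivative g' y) (at y within S)"
    and g': "\<And>b. b \<in> Basis \<Longrightarrow> vanishes n S a (\<lambda>y. g' y b)"
  shows "vanishes (Suc n) S a (\<lambda>y. g y - g a)"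
proof -
  have "\<forall>b\<in>Basis. \<exists>C. C \<ge> 0 \<and>
      (\<forall>\<^sub>F y in nhds a. y \<in> S \<longrightarrow> norm (g' y b) \<le> C * norm (y - a) ^ n)"
  proof
    fix b :: 'a assume "b \<in> Basis"
    from g'[OF this] show "\<exists>C. C \<ge> 0 \<and>
      (\<forall>\<^sub>F y in nhds a. y \<in> S \<longrightarrow> norm (g' y b) \<le> C * norm (y - a) ^ n)"
      by (rule vanishesE) blast
  qed
  from bchoice[OF this] obtain C where C: "\<forall>b\<in>Basis. C b \<ge> 0 \<and>
      (\<forall>\<^sub>F y in nhds a. y \<in> S \<longrightarrow> norm (g' y b) \<le> C b * norm (y - a) ^ n)" ..
  have "\<forall>\<^sub>F y in nhds a. \<forall>b\<in>Basis. y \<in> S \<longrightarrow> norm (g' y b) \<le> C b * norm (y - a) ^ n"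
    using C by (intro eventually_ball_finite) auto
  then obtain d where d: "d > 0" "\<And>y b. dist y a < d \<Longrightarrow> b \<in> Basis \<Longrightarrow> y \<in> S \<Longrightarrow>
      norm (g' y b) \<le> C b * norm (y - a) ^ n"
    unfolding eventually_nhds_metric by blast
  let ?K = "\<Sum>b\<in>Basis. C b"
  have "norm (g y - g a) \<le> ?K * norm (y - a) ^ Suc n" if y: "y \<in> S" "dist y a < d" for y
  proof -
    let ?S = "S \<inter> cball a (norm (y - a))"
    have "norm (g y - g a) \<le> (?K * norm (y - a) ^ n) * norm (y - a)"
    proof (rule differentiable_bound[where S = ?S and f' = g'])
      show "convex ?S" using S by (intro convex_Int convex_cball)
      show "(g has_derivative g' z) (at z within ?S)" if "z \<in> ?S" for z
        using g[of z] that by (auto intro: has_derivative_subset)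
      show "onorm (g' z) \<le> ?K * norm (y - a) ^ n" if z: "z \<in> ?S" for z
      proof -
        have bl: "bounded_linear (g' z)"
          using g[of z] z by (auto intro: has_derivative_bounded_linear)
        have nz: "norm (z - a) \<le> norm (y - a)"
          using z by (simp add: dist_norm norm_minus_commute)
        have "onorm (g' z) \<le> (\<Sum>b\<in>Basis. norm (g' z b))"
          by (rule onorm_componentwise[OF bl])
        also have "\<dots> \<le> (\<Sum>b\<in>Basis. C b * norm (y - a) ^ n)"
        proof (rule sum_mono)
          fix b :: 'a assume b: "b \<in> Basis"
          have "norm (g' z b) \<le> C b * norm (z - a) ^ n"
            using d(2)[of z b] b z nz y by (simp add: dist_norm)
          also have "\<dots> \<le> C b * norm (y - a) ^ n"
            using nz C b by (intro mult_left_mono power_mono) auto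
          finally show "norm (g' z b) \<le> C b * norm (y - a) ^ n" .
        qed
        finally show ?thesis by (simp add: sum_distrib_right)
      qed
    qed (use y S in \<open>auto simp: dist_norm norm_minus_commute\<close>)
    then show ?thesis by (simp add: mult_ac)
  qed
  then show ?thesis
    unfolding vanishes_def eventually_nhds_metric using d(1) by blast
qed

lemma vanishes_taylor1:
  fixes f :: "'a::euclidean_space \<Rightarrow> 'b::real_normed_vector"
  assumes S: "convex S" "a \<in> S"
    and f: "\<And>y. y \<in> S \<Longrightarrow> (f has_derivative f' y) (at y within S)"
    and f': "\<And>b. b \<in> Basis \<Longrightarrow> (\<lambda>y. f' y b) differentiable (at a within S)"
  shows "vanishes 2 S a (\<lambda>y. f y - f a - f' a (y - a))"
proof -
  have bl: "bounded_linear (f' a)"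
    using f[OF S(2)] by (rule has_derivative_bounded_linear)
  then have lin: "linear (f' a)" by (rule bounded_linear.linear)
  let ?g = "\<lambda>y. f y - f' a (y - a)"
  have "vanishes (Suc 1) S a (\<lambda>y. ?g y - ?g a)"
  proof (rule vanishes_integrate[OF S])
    show "(?g has_derivative (\<lambda>h. f' y h - f' a h)) (at y within S)" if "y \<in> S" for y
    proof -
      have "((\<lambda>y. y - a) has_derivative (\<lambda>h. h)) (at y within S)"
        by (auto intro!: derivative_eq_intros)
      from has_derivative_diff[OF f[OF that] bounded_linear.has_derivative[OF bl this]]
      show ?thesis .
    qed
    show "vanishes 1 S a (\<lambda>y. f' y b - f' a b)" if "b \<in> Basis" for b
      using f'[OF that] vanishes_has_derivative unfolding differentiable_def by blast
  qed
  then have "vanishes 2 S a (\<lambda>y. ?g y - ?g a)" by (simp only: Suc_1)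
  then show ?thesis by (rule vanishes_cong) (simp add: linear_0[OF lin])
qed

lemma vanishes_taylor2:
  fixes g :: "real \<Rightarrow> 'b::real_normed_vector"
  assumes S: "convex S" "a \<in> S"
    and g: "\<And>y. y \<in> S \<Longrightarrow> (g has_vector_derivative g1 y) (at y within S)"
    and g1: "\<And>y. y \<in> S \<Longrightarrow> (g1 has_vector_derivative g2 y) (at y within S)"
    and g2: "g2 differentiable (at a within S)"
  shows "vanishes 3 S a (\<lambda>y. g y - g a - (y - a) *\<^sub>R g1 a - ((y - a)\<^sup>2 / 2) *\<^sub>R g2 a)"
proof -
  let ?h = "\<lambda>y. g y - (y - a) *\<^sub>R g1 a - ((y - a)\<^sup>2 / 2) *\<^sub>R g2 a"
  have taylor1: "vanishes 2 S a (\<lambda>y. g1 y - g1 a - (y - a) *\<^sub>R g2 a)"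
  proof (rule vanishes_taylor1[OF S, where f' = "\<lambda>y h. h *\<^sub>R g2 y"])
    show "(g1 has_derivative (\<lambda>h. h *\<^sub>R g2 y)) (at y within S)" if "y \<in> S" for y
      using g1[OF that] by (simp add: has_vector_derivative_def)
    show "(\<lambda>y. b *\<^sub>R g2 y) differentiable (at a within S)" for b
      using g2 by (intro differentiable_scaleR differentiable_const)
  qed
  have "vanishes (Suc 2) S a (\<lambda>y. ?h y - ?h a)"
  proof (rule vanishes_integrate[OF S])
    show "(?h has_derivative (\<lambda>h. h *\<^sub>R (g1 y - g1 a - (y - a) *\<^sub>R g2 a))) (at y within S)"
      if "y \<in> S" for y
    proof -
      have "((\<lambda>y. (y - a)\<^sup>2 / 2) has_derivative (\<lambda>h. h * (y - a))) (at y within S)"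
        by (auto intro!: derivative_eq_intros simp: power2_eq_square)
      from has_derivative_scaleR_left[OF this, of "g2 a"]
      have "((\<lambda>y. ((y - a)\<^sup>2 / 2) *\<^sub>R g2 a) has_derivative (\<lambda>h. (h * (y - a)) *\<^sub>R g2 a)) (at y within S)" .
      moreover have "((\<lambda>y. (y - a) *\<^sub>R g1 a) has_derivative (\<lambda>h. h *\<^sub>R g1 a)) (at y within S)"
        by (auto intro!: derivative_eq_intros)
      moreover have "(g has_derivative (\<lambda>h. h *\<^sub>R g1 y)) (at y within S)"
        using g[OF that] unfolding has_vector_derivative_def .
      ultimately have "(?h has_derivative
          (\<lambda>h. h *\<^sub>R g1 y - h *\<^sub>R g1 a - (h * (y - a)) *\<^sub>R g2 a)) (at y within S)"
        by (intro has_derivative_diff)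
      then show ?thesis by (simp add: scaleR_diff_right)
    qed
    show "vanishes 2 S a (\<lambda>y. b *\<^sub>R (g1 y - g1 a - (y - a) *\<^sub>R g2 a))" for b
      by (rule vanishes_bounded_linear[OF bounded_linear_scaleR_right taylor1])
  qed
  then have "vanishes 3 S a (\<lambda>y. ?h y - ?h a)" by (simp only: numeral_3_eq_3 numeral_2_eq_2)
  then show ?thesis by (rule vanishes_cong) simp
qed

text \<open>
  First-order chain rule with quadratic remainder, for a curve \<open>c\<close> that is itself known only up to
  \<open>O(t\<^sup>2)\<close>.
\<close>

lemma vanishes_curve_expansion:
  assumes "vanishes 2 UNIV b (\<lambda>y. h y - h b - D (y - b))" "bounded_linear D"
    and "vanishes 2 S 0 (\<lambda>t. c t - b - t *\<^sub>R p)"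
  shows "vanishes 2 S (0::real) (\<lambda>t. h (c t) - h b - t *\<^sub>R D p)"
proof -
  interpret D: bounded_linear D by fact
  have "vanishes 1 S 0 (\<lambda>t. c t - b - t *\<^sub>R p)"
    by (rule vanishes_mono[OF assms(3)]) simp
  from vanishes_add[OF this vanishes_power_scaleR[of 1 S p]]
  have "vanishes 1 S 0 (\<lambda>t. c t - b)" by simp
  then have "vanishes 2 S 0 (\<lambda>t. h (c t) - h b - D (c t - b))"
    by (rule vanishes_compose[OF assms(1)])
  from vanishes_add[OF this vanishes_bounded_linear[OF assms(2,3)]]
  show ?thesis by (rule vanishes_cong) (simp add: D.diff D.scaleR)
qed

section \<open>Symmetry of mixed derivatives up to the boundary\<close>

text \<open>
  For fixed \<open>s\<close>, the mean value inequality is applied in the direction \<open>u\<close> to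
  \<open>\<tau> \<mapsto> f (x + \<tau> u + s v) - f (x + \<tau> u)\<close>. Its derivative is a difference of two values of
  \<open>\<lambda>y. f' y u\<close>, hence \<open>s Du v + o(s)\<close>. Only a parallelogram on one side of \<open>x\<close> is used.
\<close>

lemma second_difference_approx:
  fixes f :: "'a::real_normed_vector \<Rightarrow> 'b::real_normed_vector"
  assumes f: "\<And>y. y \<in> S \<Longrightarrow> (f has_derivative f' y) (at y within S)"
    and Du: "((\<lambda>y. f' y u) has_derivative Du) (at x within S)"
    and "\<delta> > 0"
    and S: "\<And>s t. 0 \<le> s \<Longrightarrow> s < \<delta> \<Longrightarrow> 0 \<le> t \<Longrightarrow> t < \<delta> \<Longrightarrow> x + s *\<^sub>R u + t *\<^sub>R v \<in> S"
    and "e > 0"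
  shows "\<exists>d>0. \<forall>s. 0 < s \<and> s < d \<longrightarrow>
    norm (f (x + s *\<^sub>R u + s *\<^sub>R v) - f (x + s *\<^sub>R u) - f (x + s *\<^sub>R v) + f x - s\<^sup>2 *\<^sub>R Du v) \<le> e * s\<^sup>2"
proof -
  have bl: "bounded_linear Du" using Du by (rule has_derivative_bounded_linear)
  then interpret Du: bounded_linear Du .
  \<comment> \<open>both corners \<open>?p \<tau>\<close>, \<open>?q \<tau>\<close> lie within \<open>s (norm u + norm v)\<close> of \<open>x\<close>; the summand 1 keeps \<open>?N\<close> positive\<close>
  let ?N = "2 * (norm u + norm v + 1)"
  have N: "?N > 0"
    by (intro mult_pos_pos add_nonneg_pos add_nonneg_nonneg norm_ge_zero) simp_all
  define \<epsilon> where "\<epsilon> = e / ?N"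
  have \<epsilon>: "\<epsilon> > 0" "\<epsilon> * ?N = e" using \<open>e > 0\<close> N by (auto simp: \<epsilon>_def)
  obtain d where d: "d > 0" "\<And>y. y \<in> S \<Longrightarrow> norm (y - x) < d \<Longrightarrow>
      norm (f' y u - f' x u - Du (y - x)) \<le> \<epsilon> * norm (y - x)"
    using Du \<epsilon>(1) unfolding has_derivative_within_alt by blast
  have "norm (f (x + s *\<^sub>R u + s *\<^sub>R v) - f (x + s *\<^sub>R u) - f (x + s *\<^sub>R v) + f x - s\<^sup>2 *\<^sub>R Du v) \<le> e * s\<^sup>2"
    if s: "0 < s" "s < min \<delta> (d / ?N)" for s
  proof -
    have sN: "s * ?N < d" using s N by (simp add: pos_less_divide_eq)
    let ?p = "\<lambda>\<tau>. x + \<tau> *\<^sub>R u + s *\<^sub>R v"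
    let ?q = "\<lambda>\<tau>. x + \<tau> *\<^sub>R u"
    let ?\<phi> = "\<lambda>\<tau>. f (?p \<tau>) - f (?q \<tau>) - \<tau> *\<^sub>R (s *\<^sub>R Du v)"
    have pS: "?p \<tau> \<in> S" and qS: "?q \<tau> \<in> S" if "\<tau> \<in> {0..s}" for \<tau>
      using S[of \<tau> s] S[of \<tau> 0] that s by auto
    have "norm (?\<phi> s - ?\<phi> 0) \<le> (e * s) * norm (s - 0)"
    proof (rule differentiable_bound[where S = "{0..s}" and f = ?\<phi> and
          f' = "\<lambda>\<tau> h. h *\<^sub>R (f' (?p \<tau>) u - f' (?q \<tau>) u - s *\<^sub>R Du v)"])
      fix \<tau> assume \<tau>: "\<tau> \<in> {0..s}"
      have dp: "(?p has_derivative (\<lambda>h. h *\<^sub>R u)) (at \<tau> within {0..s})"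
        and dq: "(?q has_derivative (\<lambda>h. h *\<^sub>R u)) (at \<tau> within {0..s})" for \<tau>
        by (auto intro!: derivative_eq_intros)
      have "((\<lambda>\<tau>. f (?p \<tau>)) has_derivative (\<lambda>h. f' (?p \<tau>) (h *\<^sub>R u))) (at \<tau> within {0..s})"
        using pS by (intro has_derivative_in_compose2[OF f _ \<tau> dp]) auto
      moreover have "((\<lambda>\<tau>. f (?q \<tau>)) has_derivative (\<lambda>h. f' (?q \<tau>) (h *\<^sub>R u))) (at \<tau> within {0..s})"
        using qS by (intro has_derivative_in_compose2[OF f _ \<tau> dq]) auto
      moreover have "((\<lambda>\<tau>. \<tau> *\<^sub>R (s *\<^sub>R Du v)) has_derivative (\<lambda>h. h *\<^sub>R (s *\<^sub>R Du v))) (at \<tau> within {0..s})"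
        by (auto intro!: derivative_eq_intros)
      ultimately have "(?\<phi> has_derivative
          (\<lambda>h. f' (?p \<tau>) (h *\<^sub>R u) - f' (?q \<tau>) (h *\<^sub>R u) - h *\<^sub>R (s *\<^sub>R Du v))) (at \<tau> within {0..s})"
        by (intro has_derivative_diff)
      moreover have "f' y (h *\<^sub>R u) = h *\<^sub>R f' y u" if "y \<in> S" for y h
        using linear_scale[OF has_derivative_linear[OF f[OF that]]] by blast
      ultimately show "(?\<phi> has_derivative (\<lambda>h. h *\<^sub>R (f' (?p \<tau>) u - f' (?q \<tau>) u - s *\<^sub>R Du v)))
          (at \<tau> within {0..s})"
        using pS[OF \<tau>] qS[OF \<tau>] by (simp add: scaleR_diff_right)
      have np: "norm (?p \<tau> - x) \<le> s * (norm u + norm v)"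
      proof -
        have "norm (\<tau> *\<^sub>R u + s *\<^sub>R v) \<le> norm (\<tau> *\<^sub>R u) + norm (s *\<^sub>R v)" by (rule norm_triangle_ineq)
        also have "\<dots> \<le> s * norm u + s * norm v"
          using \<tau> s by (auto intro!: add_mono mult_right_mono)
        finally show ?thesis by (simp add: distrib_left add.assoc)
      qed
      have nq: "norm (?q \<tau> - x) \<le> s * (norm u + norm v)"
      proof -
        have "norm (\<tau> *\<^sub>R u) \<le> s * norm u" using \<tau> by (auto intro!: mult_right_mono)
        also have "\<dots> \<le> s * (norm u + norm v)" using s by (intro mult_left_mono) auto
        finally show ?thesis by simp
      qed
      have "s * (norm u + norm v) \<le> s * ?N"
        using s by (intro mult_left_mono) auto
      then have small: "s * (norm u + norm v) < d" using sN by linarith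
      have "f' (?p \<tau>) u - f' (?q \<tau>) u - s *\<^sub>R Du v =
          (f' (?p \<tau>) u - f' x u - Du (?p \<tau> - x)) - (f' (?q \<tau>) u - f' x u - Du (?q \<tau> - x))"
        by (simp add: Du.add Du.scaleR)
      then have "norm (f' (?p \<tau>) u - f' (?q \<tau>) u - s *\<^sub>R Du v) \<le>
          norm (f' (?p \<tau>) u - f' x u - Du (?p \<tau> - x)) + norm (f' (?q \<tau>) u - f' x u - Du (?q \<tau> - x))"
        by (metis norm_triangle_ineq4)
      also have "\<dots> \<le> \<epsilon> * norm (?p \<tau> - x) + \<epsilon> * norm (?q \<tau> - x)"
        using d(2)[OF pS[OF \<tau>]] d(2)[OF qS[OF \<tau>]] np nq small by (intro add_mono) linarith+
      also have "\<dots> \<le> \<epsilon> * (s * (norm u + norm v)) + \<epsilon> * (s * (norm u + norm v))"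
        using np nq \<epsilon>(1) by (intro add_mono mult_left_mono) auto
      also have "\<dots> \<le> \<epsilon> * ?N * s"
        using \<epsilon>(1) s by (simp add: algebra_simps)
      finally have "norm (f' (?p \<tau>) u - f' (?q \<tau>) u - s *\<^sub>R Du v) \<le> e * s"
        using \<epsilon>(2) by simp
      then show "onorm (\<lambda>h::real. h *\<^sub>R (f' (?p \<tau>) u - f' (?q \<tau>) u - s *\<^sub>R Du v)) \<le> e * s"
        by (intro onorm_le) (simp add: mult.commute mult_left_mono)
    qed (use s in auto)
    moreover have "?\<phi> s - ?\<phi> 0 =
        f (x + s *\<^sub>R u + s *\<^sub>R v) - f (x + s *\<^sub>R u) - f (x + s *\<^sub>R v) + f x - s\<^sup>2 *\<^sub>R Du v"
      by (simp add: power2_eq_square)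
    moreover have "(e * s) * norm (s - 0) = e * s\<^sup>2"
      using s by (simp add: power2_eq_square)
    ultimately show ?thesis by (simp only:)
  qed
  then show ?thesis using d(1) \<open>\<delta> > 0\<close> N
    by (intro exI[of _ "min \<delta> (d / ?N)"]) auto
qed

text \<open>
  The second difference is symmetric in \<open>u\<close> and \<open>v\<close>, so its two approximations agree. The point \<open>x\<close>
  may lie on the boundary of \<open>S\<close>, as \<open>t = 0\<close> does for the time strip.
\<close>

lemma mixed_derivatives_symmetric:
  fixes f :: "'a::real_normed_vector \<Rightarrow> 'b::real_normed_vector"
  assumes f: "\<And>y. y \<in> S \<Longrightarrow> (f has_derivative f' y) (at y within S)"
    and Du: "((\<lambda>y. f' y u) has_derivative Du) (at x within S)"
    and Dv: "((\<lambda>y. f' y v) has_derivative Dv) (at x within S)"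
    and \<delta>: "\<delta> > 0"
    and S: "\<And>s t. 0 \<le> s \<Longrightarrow> s < \<delta> \<Longrightarrow> 0 \<le> t \<Longrightarrow> t < \<delta> \<Longrightarrow> x + s *\<^sub>R u + t *\<^sub>R v \<in> S"
  shows "Du v = Dv u"
proof -
  have "norm (Du v - Dv u) \<le> 0 + e" if "e > 0" for e
  proof -
    have e2: "e / 2 > 0" using that by simp
    have S': "x + s *\<^sub>R v + t *\<^sub>R u \<in> S" if "0 \<le> s" "s < \<delta>" "0 \<le> t" "t < \<delta>" for s t
      using S[of t s] that by (simp add: add_ac)
    obtain d1 where d1: "d1 > 0" "\<forall>s. 0 < s \<and> s < d1 \<longrightarrow> norm (f (x + s *\<^sub>R u + s *\<^sub>R v)
        - f (x + s *\<^sub>R u) - f (x + s *\<^sub>R v) + f x - s\<^sup>2 *\<^sub>R Du v) \<le> e / 2 * s\<^sup>2"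
      using second_difference_approx[OF f Du \<delta> S e2] by blast
    obtain d2 where d2: "d2 > 0" "\<forall>s. 0 < s \<and> s < d2 \<longrightarrow> norm (f (x + s *\<^sub>R v + s *\<^sub>R u)
        - f (x + s *\<^sub>R v) - f (x + s *\<^sub>R u) + f x - s\<^sup>2 *\<^sub>R Dv u) \<le> e / 2 * s\<^sup>2"
      using second_difference_approx[OF f Dv \<delta> S' e2] by blast
    define s where "s = min d1 d2 / 2"
    have s: "0 < s" "s < d1" "s < d2" using d1(1) d2(1) by (auto simp: s_def)
    define \<Delta> where "\<Delta> = f (x + s *\<^sub>R u + s *\<^sub>R v) - f (x + s *\<^sub>R u) - f (x + s *\<^sub>R v) + f x"
    have "norm (\<Delta> - s\<^sup>2 *\<^sub>R Du v) \<le> e / 2 * s\<^sup>2"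
      using d1(2)[rule_format, OF conjI, OF s(1,2)] unfolding \<Delta>_def .
    moreover have "norm (\<Delta> - s\<^sup>2 *\<^sub>R Dv u) \<le> e / 2 * s\<^sup>2"
    proof -
      have "x + s *\<^sub>R v + s *\<^sub>R u = x + s *\<^sub>R u + s *\<^sub>R v" by (simp add: add_ac)
      moreover have "a - b - c + d = a - c - b + d" for a b c d :: 'b by (simp add: algebra_simps)
      ultimately have "f (x + s *\<^sub>R v + s *\<^sub>R u) - f (x + s *\<^sub>R v) - f (x + s *\<^sub>R u) + f x = \<Delta>"
        unfolding \<Delta>_def by metis
      then show ?thesis using d2(2)[rule_format, OF conjI, OF s(1,3)] by (simp only:)
    qed
    moreover have "norm (s\<^sup>2 *\<^sub>R (Du v - Dv u)) =
        norm ((\<Delta> - s\<^sup>2 *\<^sub>R Dv u) - (\<Delta> - s\<^sup>2 *\<^sub>R Du v))"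
      by (simp add: scaleR_diff_right)
    ultimately have "norm (s\<^sup>2 *\<^sub>R (Du v - Dv u)) \<le> e * s\<^sup>2"
      using norm_triangle_ineq4[of "\<Delta> - s\<^sup>2 *\<^sub>R Dv u" "\<Delta> - s\<^sup>2 *\<^sub>R Du v"] by linarith
    then show ?thesis using s(1) by (simp add: mult.commute)
  qed
  then have "norm (Du v - Dv u) \<le> 0" by (rule field_le_epsilon)
  then show ?thesis by simp
qed

section \<open>Expansion of the solution in time\<close>

text \<open>
  Product rule for \<open>A (c s) (w s)\<close> when only the directional maps \<open>u \<mapsto> A u v\<close> are known to be
  differentiable, as the definition of smoothness provides. Expanding the second argument in the basis
  reduces it to finitely many such maps, and uniqueness of derivatives shows that \<open>G v\<close> is linear in
  \<open>v\<close>.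
\<close>

lemma has_vector_derivative_linear_family:
  fixes A :: "'a::real_normed_vector \<Rightarrow> 'b::euclidean_space \<Rightarrow> 'c::real_normed_vector"
  assumes lin: "\<And>u. linear (A u)"
    and G: "\<And>v. ((\<lambda>u. A u v) has_derivative G v) (at (c a))"
    and c: "(c has_vector_derivative c') (at a within S)"
    and w: "(w has_vector_derivative w') (at a within S)"
  shows "((\<lambda>s. A (c s) (w s)) has_vector_derivative A (c a) w' + G (w a) c') (at a within S)"
proof -
  have A: "A u z = (\<Sum>b\<in>Basis. (z \<bullet> b) *\<^sub>R A u b)" for u z
    by (subst euclidean_representation[of z, symmetric])
       (simp only: linear_sum[OF lin] linear_scale[OF lin])
  have "G z = (\<lambda>h. \<Sum>b\<in>Basis. (z \<bullet> b) *\<^sub>R G b h)" for z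
  proof (rule has_derivative_unique[OF G])
    have "((\<lambda>u. \<Sum>b\<in>Basis. (z \<bullet> b) *\<^sub>R A u b) has_derivative (\<lambda>h. \<Sum>b\<in>Basis. (z \<bullet> b) *\<^sub>R G b h)) (at (c a))"
      by (intro has_derivative_sum has_derivative_scaleR_right G)
    then show "((\<lambda>u. A u z) has_derivative (\<lambda>h. \<Sum>b\<in>Basis. (z \<bullet> b) *\<^sub>R G b h)) (at (c a))"
      by (simp only: A[symmetric])
  qed
  then have Gz: "G z h = (\<Sum>b\<in>Basis. (z \<bullet> b) *\<^sub>R G b h)" for z h by (rule fun_cong)
  have "((\<lambda>s. \<Sum>b\<in>Basis. (w s \<bullet> b) *\<^sub>R A (c s) b) has_vector_derivative
      (\<Sum>b\<in>Basis. (w a \<bullet> b) *\<^sub>R G b c' + (w' \<bullet> b) *\<^sub>R A (c a) b)) (at a within S)"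
  proof (intro has_vector_derivative_sum has_vector_derivative_scaleR)
    fix b :: 'b
    show "((\<lambda>s. w s \<bullet> b) has_field_derivative w' \<bullet> b) (at a within S)"
      using bounded_linear.has_vector_derivative[OF bounded_linear_inner_left w]
      by (simp add: has_real_derivative_iff_has_vector_derivative)
    have "((\<lambda>u. A u b) has_derivative G b) (at (c a) within c ` S)"
      using G by (rule has_derivative_at_withinI)
    from vector_derivative_diff_chain_within[OF c this]
    show "((\<lambda>s. A (c s) b) has_vector_derivative G b c') (at a within S)"
      by (simp add: o_def)
  qed
  moreover have "(\<Sum>b\<in>Basis. (w a \<bullet> b) *\<^sub>R G b c' + (w' \<bullet> b) *\<^sub>R A (c a) b) = A (c a) w' + G (w a) c'"
    by (simp only: sum.distrib A[symmetric] Gz[symmetric] add.commute)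
  ultimately show ?thesis by (simp only: A[symmetric])
qed

lemma strip_time_slice:
  fixes F :: "real \<times> real \<Rightarrow> 'b::real_normed_vector"
  assumes "(F has_derivative D) (at (t, y) within {0..<T} \<times> UNIV)"
  shows "((\<lambda>s. F (s, y)) has_vector_derivative D (1, 0)) (at t within {0..<T})"
proof -
  have "((\<lambda>s. (s, y)) has_derivative (\<lambda>h. (h, 0))) (at t within {0..<T})"
    by (rule has_derivative_Pair[OF has_derivative_ident has_derivative_const])
  moreover have "(F has_derivative D) (at (t, y) within (\<lambda>s. (s, y)) ` {0..<T})"
    using assms by (rule has_derivative_subset) auto
  ultimately have "((\<lambda>s. F (s, y)) has_derivative (\<lambda>h. D (h, 0))) (at t within {0..<T})"
    by (rule has_derivative_in_compose)
  moreover have "(\<lambda>h. D (h, 0)) = (\<lambda>h. h *\<^sub>R D (1, 0))"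
  proof
    show "D (h, 0) = h *\<^sub>R D (1, 0)" for h
      using linear_scale[OF has_derivative_linear[OF assms], of h "(1, 0)"] by simp
  qed
  ultimately show ?thesis by (simp only: has_vector_derivative_def)
qed

lemma strip_space_slice:
  fixes F :: "real \<times> real \<Rightarrow> 'b::real_normed_vector"
  assumes "(F has_derivative D) (at (t, y) within {0..<T} \<times> UNIV)" "t \<in> {0..<T}"
  shows "((\<lambda>z. F (t, z)) has_vector_derivative D (0, 1)) (at y)"
proof -
  have "((\<lambda>z. (t, z)) has_derivative (\<lambda>h. (0, h))) (at y)"
    by (rule has_derivative_Pair[OF has_derivative_const has_derivative_ident])
  moreover have "(F has_derivative D) (at (t, y) within (\<lambda>z. (t, z)) ` UNIV)"
    using assms(1) by (rule has_derivative_subset) (use assms(2) in auto)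
  ultimately have "((\<lambda>z. F (t, z)) has_derivative (\<lambda>h. D (0, h))) (at y)"
    by (rule has_derivative_in_compose)
  moreover have "(\<lambda>h. D (0, h)) = (\<lambda>h. h *\<^sub>R D (0, 1))"
  proof
    show "D (0, h) = h *\<^sub>R D (0, 1)" for h
      using linear_scale[OF has_derivative_linear[OF assms(1)], of h "(0, 1)"] by simp
  qed
  ultimately show ?thesis by (simp only: has_vector_derivative_def)
qed

text \<open>
  With \<open>G v h\<close> for the derivative of \<open>u \<mapsto> f' u v\<close> in the direction \<open>h\<close>: the equation
  \<open>q\<^sub>t = - f' q q\<^sub>x\<close> is differentiated in \<open>t\<close> at \<open>t = 0\<close>, giving \<open>q\<^sub>t\<^sub>t = - f' u q\<^sub>x\<^sub>t - G v q\<^sub>t\<close>, and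
  \<open>q\<^sub>x\<^sub>t = q\<^sub>t\<^sub>x\<close> is computed by differentiating \<open>q\<^sub>t = - f' q0 q0'\<close> along the initial line.
\<close>

lemma solution_time_expansion:
  fixes f :: "real ^ 'm::finite \<Rightarrow> real ^ 'm"
  assumes f': "\<And>u. (f has_derivative f' u) (at u)"
    and G: "\<And>v. ((\<lambda>u. f' u v) has_derivative G v) (at (q0 x))"
    and q1: "\<And>y. (q0 has_vector_derivative q1 y) (at y)"
    and w: "(q1 has_vector_derivative w) (at x)"
    and T: "T > 0"
    and sol: "smooth_solution f q0 T q"
  shows "vanishes 3 {0..<T} 0 (\<lambda>t. q t x - q0 x + t *\<^sub>R f' (q0 x) (q1 x)
    - (t\<^sup>2 / 2) *\<^sub>R (f' (q0 x) (f' (q0 x) w + G (q1 x) (q1 x)) + G (q1 x) (f' (q0 x) (q1 x))))"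
proof -
  let ?I = "{0..<T}"
  let ?S = "?I \<times> (UNIV :: real set)"
  let ?Q = "\<lambda>(t, y). q t y"
  have initial: "q 0 y = q0 y" for y
    using sol by (simp add: smooth_solution_def)
  have zero_I: "0 \<in> ?I" using T by simp
  \<comment> \<open>needed for time derivatives within \<open>?I\<close> to be unique, in particular at the endpoint 0\<close>
  have nontrivial: "at t within ?I \<noteq> bot" if "t \<in> ?I" for t
  proof -
    have "?I \<noteq> {y}" for y
    proof
      assume "?I = {y}"
      moreover have "0 \<in> ?I" "T / 2 \<in> ?I" using T by auto
      ultimately show False using T by auto
    qed
    then have "t islimpt ?I"
      using that by (intro connected_imp_perfect) auto
    then show ?thesis by (simp add: trivial_limit_within)
  qed
  have "Ck_on (Suc (Suc (Suc 0))) ?S ?Q"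
    using sol unfolding smooth_solution_def smooth_on_def by blast
  then obtain Q' where Q': "\<And>p. p \<in> ?S \<Longrightarrow> (?Q has_derivative Q' p) (at p within ?S)"
      and Q'C: "\<And>v. Ck_on (Suc (Suc 0)) ?S (\<lambda>p. Q' p v)"
    by (subst (asm) Ck_on.simps(2)) blast
  define Qt where "Qt p = Q' p (1, 0)" for p
  define Qx where "Qx p = Q' p (0, 1)" for p
  have "Ck_on (Suc (Suc 0)) ?S Qt" using Q'C unfolding Qt_def .
  then obtain Qt' where Qt': "\<And>p. p \<in> ?S \<Longrightarrow> (Qt has_derivative Qt' p) (at p within ?S)"
      and Qt'C: "\<And>v. Ck_on (Suc 0) ?S (\<lambda>p. Qt' p v)"
    by (subst (asm) Ck_on.simps(2)) blast
  have "Ck_on (Suc (Suc 0)) ?S Qx" using Q'C unfolding Qx_def .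
  then obtain Qx' where Qx': "\<And>p. p \<in> ?S \<Longrightarrow> (Qx has_derivative Qx' p) (at p within ?S)"
    by (subst (asm) Ck_on.simps(2)) blast
  have "Ck_on (Suc 0) ?S (\<lambda>p. Qt' p (1, 0))" by (rule Qt'C)
  then obtain Qtt' where Qtt': "\<And>p. p \<in> ?S \<Longrightarrow> ((\<lambda>p. Qt' p (1, 0)) has_derivative Qtt' p) (at p within ?S)"
    by (subst (asm) Ck_on.simps(2)) blast
  have q_t: "((\<lambda>s. q s y) has_vector_derivative Qt (t, y)) (at t within ?I)" if "t \<in> ?I" for t y
    using strip_time_slice[OF Q'[of "(t, y)"]] that by (simp add: Qt_def)
  have q_x: "((\<lambda>z. q t z) has_vector_derivative Qx (t, y)) (at y)" if "t \<in> ?I" for t y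
    using strip_space_slice[OF Q'[of "(t, y)"]] that by (simp add: Qx_def)
  have pde: "Qt (t, y) = - f' (q t y) (Qx (t, y))" if t: "t \<in> ?I" for t y
  proof -
    have "vector_derivative (\<lambda>s. q s y) (at t within ?I) + vector_derivative (\<lambda>z. f (q t z)) (at y) = 0"
      using sol t unfolding smooth_solution_def by blast
    moreover have "vector_derivative (\<lambda>s. q s y) (at t within ?I) = Qt (t, y)"
      by (rule vector_derivative_within[OF nontrivial[OF t] q_t[OF t]])
    moreover have "vector_derivative (\<lambda>z. f (q t z)) (at y) = f' (q t y) (Qx (t, y))"
    proof (rule vector_derivative_at)
      have "(f has_derivative f' (q t y)) (at (q t y) within q t ` UNIV)"
        by (rule has_derivative_at_withinI[OF f'])
      from vector_derivative_diff_chain_within[OF q_x[OF t] this]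
      show "((\<lambda>z. f (q t z)) has_vector_derivative f' (q t y) (Qx (t, y))) (at y)"
        by (simp add: o_def)
    qed
    ultimately show ?thesis by (simp add: eq_neg_iff_add_eq_0)
  qed
  have Qx0: "Qx (0, y) = q1 y" for y
    using vector_derivative_unique_at[OF q_x[OF zero_I, of y]] q1[of y] by (simp add: initial)
  have lin: "linear (f' u)" for u by (rule has_derivative_linear[OF f'])
  have Qt0: "Qt (0, x) = - f' (q0 x) (q1 x)"
    using pde[OF zero_I] by (simp add: initial Qx0)
  have pS: "(0, x) \<in> ?S" using zero_I by simp
  have Qtx: "Qt' (0, x) (0, 1) = - (f' (q0 x) w + G (q1 x) (q1 x))"
  proof (rule vector_derivative_unique_at)
    show "((\<lambda>z. Qt (0, z)) has_vector_derivative Qt' (0, x) (0, 1)) (at x)"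
      by (rule strip_space_slice[OF Qt'[OF pS] zero_I])
    have "((\<lambda>z. f' (q0 z) (q1 z)) has_vector_derivative f' (q0 x) w + G (q1 x) (q1 x)) (at x)"
      by (rule has_vector_derivative_linear_family[OF lin G q1 w])
    then have "((\<lambda>z. - f' (q0 z) (q1 z)) has_vector_derivative - (f' (q0 x) w + G (q1 x) (q1 x))) (at x)"
      by (rule has_vector_derivative_minus)
    moreover have "(\<lambda>z. - f' (q0 z) (q1 z)) = (\<lambda>z. Qt (0, z))"
      by (simp add: pde[OF zero_I] initial Qx0)
    ultimately show "((\<lambda>z. Qt (0, z)) has_vector_derivative - (f' (q0 x) w + G (q1 x) (q1 x))) (at x)"
      by simp
  qed
  have sym: "Qt' (0, x) (0, 1) = Qx' (0, x) (1, 0)"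
  proof (rule mixed_derivatives_symmetric[where S = ?S and f = ?Q and f' = Q' and \<delta> = T])
    show "(?Q has_derivative Q' p) (at p within ?S)" if "p \<in> ?S" for p using Q'[OF that] .
    show "((\<lambda>p. Q' p (1, 0)) has_derivative Qt' (0, x)) (at (0, x) within ?S)"
      using Qt'[OF pS] unfolding Qt_def .
    show "((\<lambda>p. Q' p (0, 1)) has_derivative Qx' (0, x)) (at (0, x) within ?S)"
      using Qx'[OF pS] unfolding Qx_def .
  qed (use T in auto)
  let ?g2 = "f' (q0 x) (f' (q0 x) w + G (q1 x) (q1 x)) + G (q1 x) (f' (q0 x) (q1 x))"
  have G0: "((\<lambda>u. f' u v) has_derivative G v) (at (q 0 x))" for v
    using G by (simp add: initial)
  have Qtt: "Qt' (0, x) (1, 0) = ?g2"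
  proof (rule vector_derivative_unique_within[OF nontrivial[OF zero_I]])
    show "((\<lambda>s. Qt (s, x)) has_vector_derivative Qt' (0, x) (1, 0)) (at 0 within ?I)"
      by (rule strip_time_slice[OF Qt'[OF pS]])
    have "((\<lambda>s. Qx (s, x)) has_vector_derivative Qx' (0, x) (1, 0)) (at 0 within ?I)"
      by (rule strip_time_slice[OF Qx'[OF pS]])
    from has_vector_derivative_linear_family[OF lin G0 q_t[OF zero_I] this]
    have "((\<lambda>s. f' (q s x) (Qx (s, x))) has_vector_derivative
        f' (q0 x) (Qx' (0, x) (1, 0)) + G (q1 x) (Qt (0, x))) (at 0 within ?I)"
      by (simp add: initial Qx0)
    from has_vector_derivative_minus[OF this]
    have "((\<lambda>s. - f' (q s x) (Qx (s, x))) has_vector_derivative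
        - (f' (q0 x) (Qx' (0, x) (1, 0)) + G (q1 x) (Qt (0, x)))) (at 0 within ?I)" .
    moreover have "- (f' (q0 x) (Qx' (0, x) (1, 0)) + G (q1 x) (Qt (0, x))) = ?g2"
      by (simp add: sym[symmetric] Qtx Qt0 linear_neg[OF lin] linear_neg[OF has_derivative_linear[OF G]]
        del: minus_add_distrib)
    ultimately have "((\<lambda>s. - f' (q s x) (Qx (s, x))) has_vector_derivative ?g2) (at 0 within ?I)"
      by (simp only:)
    then show "((\<lambda>s. Qt (s, x)) has_vector_derivative ?g2) (at 0 within ?I)"
      by (rule has_vector_derivative_transform[OF zero_I, rotated]) (rule pde)
  qed
  have "vanishes 3 ?I 0 (\<lambda>t. q t x - q 0 x - (t - 0) *\<^sub>R Qt (0, x)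
      - ((t - 0)\<^sup>2 / 2) *\<^sub>R Qt' (0, x) (1, 0))"
  proof (rule vanishes_taylor2[of ?I 0 "\<lambda>t. q t x" "\<lambda>t. Qt (t, x)" "\<lambda>t. Qt' (t, x) (1, 0)"])
    show "((\<lambda>t. q t x) has_vector_derivative Qt (t, x)) (at t within ?I)" if "t \<in> ?I" for t
      by (rule q_t[OF that])
    show "((\<lambda>t. Qt (t, x)) has_vector_derivative Qt' (t, x) (1, 0)) (at t within ?I)" if "t \<in> ?I" for t
      using strip_time_slice[OF Qt'[of "(t, x)"]] that by simp
    show "(\<lambda>t. Qt' (t, x) (1, 0)) differentiable (at 0 within ?I)"
      using strip_time_slice[OF Qtt'[OF pS]] by (auto simp: has_vector_derivative_def differentiable_def)
  qed (use T in auto)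
  then show ?thesis
    by (rule vanishes_cong) (simp add: Qt0 Qtt initial)
qed

lemma smooth_on_real_derivatives:
  fixes g :: "real \<Rightarrow> 'b::real_normed_vector"
  assumes "smooth_on UNIV g"
  obtains g1 g2 where "\<And>y. (g has_vector_derivative g1 y) (at y)"
    "\<And>y. (g1 has_vector_derivative g2 y) (at y)" "\<And>y. g2 differentiable (at y)"
proof -
  have step: "\<exists>h1. (\<forall>y. (h has_vector_derivative h1 y) (at y)) \<and> Ck_on n UNIV h1"
    if Ck: "Ck_on (Suc n) UNIV h" for n and h :: "real \<Rightarrow> 'b"
  proof -
    obtain h' where h': "\<And>y. (h has_derivative h' y) (at y)" and C: "\<And>v. Ck_on n UNIV (\<lambda>y. h' y v)"
      using Ck by (subst (asm) Ck_on.simps(2)) auto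
    have "(h has_vector_derivative h' y 1) (at y)" for y
    proof -
      have "h' y = (\<lambda>k. k *\<^sub>R h' y 1)"
      proof
        fix k show "h' y k = k *\<^sub>R h' y 1"
          using linear_scale[OF has_derivative_linear[OF h'], of y k 1] by simp
      qed
      then show ?thesis using h'[of y] unfolding has_vector_derivative_def by (simp only:)
    qed
    then show ?thesis using C[of 1] by (intro exI[of _ "\<lambda>y. h' y 1"]) simp
  qed
  have "Ck_on (Suc (Suc (Suc 0))) UNIV g" using assms unfolding smooth_on_def by blast
  from step[OF this] obtain g1 where g1: "\<forall>y. (g has_vector_derivative g1 y) (at y)"
    "Ck_on (Suc (Suc 0)) UNIV g1" by blast
  from step[OF g1(2)] obtain g2 where g2: "\<forall>y. (g1 has_vector_derivative g2 y) (at y)"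
    "Ck_on (Suc 0) UNIV g2" by blast
  from step[OF g2(2)] obtain g3 where g3: "\<forall>y. (g2 has_vector_derivative g3 y) (at y)" by blast
  show ?thesis
  proof (rule that)
    show "g2 differentiable (at y)" for y
      using g3 unfolding has_vector_derivative_def differentiable_def by blast
  qed (use g1 g2 in blast)+
qed

lemma smooth_on_UNIV_derivatives:
  fixes h :: "'a::euclidean_space \<Rightarrow> 'b::real_normed_vector"
  assumes "smooth_on UNIV h"
  obtains h' where "\<And>u. (h has_derivative h' u) (at u)"
    "\<And>u v. (\<lambda>u. h' u v) differentiable (at u)"
proof -
  have "Ck_on (Suc (Suc 0)) UNIV h" using assms unfolding smooth_on_def by blast
  then obtain h' where h': "\<And>u. (h has_derivative h' u) (at u)"
      and C: "\<And>v. Ck_on (Suc 0) UNIV (\<lambda>u. h' u v)"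
    by (subst (asm) Ck_on.simps(2)) auto
  have "(\<lambda>u. h' u v) differentiable (at u)" for u v
    using C[of v] by (auto simp: differentiable_def)
  with h' show ?thesis by (rule that)
qed

section \<open>Spectral decomposition of the Jacobian and the predictor\<close>

lemma diagonal_mult_vec: "(diagonal c *v y) $ i = c i * y $ i"
  by (simp add: matrix_vector_mult_def diagonal_def if_distrib if_distribR cong: if_cong)

lemma eigen_proj_spectral_sum:
  "(\<Sum>k\<in>UNIV. c k *\<^sub>R (eigen_proj R k u *v z)) = matrix_inv (R u) *v (diagonal c *v (R u *v z))"
proof -
  let ?E = "\<lambda>k. diagonal (\<lambda>j. if j = k then 1 else 0)"
  have "(\<Sum>k\<in>UNIV. c k *\<^sub>R (eigen_proj R k u *v z)) =
      (\<Sum>k\<in>UNIV. matrix_inv (R u) *v (c k *\<^sub>R (?E k *v (R u *v z))))"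
    by (simp add: eigen_proj_def matrix_vector_mul_assoc[symmetric] matrix_vector_mult_scaleR)
  also have "\<dots> = matrix_inv (R u) *v (\<Sum>k\<in>UNIV. c k *\<^sub>R (?E k *v (R u *v z)))"
    by (rule linear_sum[OF matrix_vector_mul_linear, symmetric])
  also have "(\<Sum>k\<in>UNIV. c k *\<^sub>R (?E k *v (R u *v z))) = diagonal c *v (R u *v z)"
    unfolding vec_eq_iff
    by (simp add: diagonal_mult_vec if_distrib if_distribR cong: if_cong)
  finally show ?thesis .
qed

lemma matrix_inv_mult_vec:
  fixes A :: "real ^ 'm ^ 'm"
  assumes "invertible A"
  shows "matrix_inv A *v (A *v z) = z" "A *v (matrix_inv A *v z) = z"
proof -
  have "A ** matrix_inv A = mat 1 \<and> matrix_inv A ** A = mat 1"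
    using assms unfolding invertible_def matrix_inv_def by (rule someI_ex)
  then show "matrix_inv A *v (A *v z) = z" "A *v (matrix_inv A *v z) = z"
    by (simp_all add: matrix_vector_mul_assoc)
qed

text \<open>
  Multiplying \<open>R\<^sup>-\<^sup>1 D R\<close> by \<open>R\<close> from the left gives \<open>D R\<close>: the rows of \<open>R\<close> are left eigenvectors of the
  Jacobian, which is how the hyperbolic structure enters.
\<close>

lemma row_eigenvector:
  fixes R :: "'a \<Rightarrow> real ^ 'm ^ 'm"
  assumes "invertible (R u)"
  shows "R u $ i \<bullet> ((matrix_inv (R u) ** diagonal d ** R u) *v z) = d i * (R u $ i \<bullet> z)"
proof -
  have "R u *v ((matrix_inv (R u) ** diagonal d ** R u) *v z) = diagonal d *v (R u *v z)"
    by (simp add: matrix_vector_mul_assoc[symmetric] matrix_inv_mult_vec[OF assms])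
  then have "(R u *v ((matrix_inv (R u) ** diagonal d ** R u) *v z)) $ i = d i * (R u *v z) $ i"
    by (simp add: diagonal_mult_vec)
  then show ?thesis by (simp only: matrix_vector_mul_component)
qed

text \<open>
  The eigenvector relation \<open>r J v = l r v\<close> differentiated in the direction \<open>p\<close>, with \<open>g u = J u v\<close> for
  a fixed vector \<open>v\<close>. It trades the derivatives of \<open>r\<close> and \<open>l\<close> for that of \<open>J\<close>, which
  is what the expansion of the solution contains.
\<close>

lemma row_eigenvector_derivative:
  fixes r :: "'a::real_inner \<Rightarrow> 'a"
  assumes rel: "\<And>u. r u \<bullet> g u = l u * (r u \<bullet> v)"
    and r: "(r has_derivative r') (at a)" and l: "(l has_derivative l') (at a)"
    and g: "(g has_derivative g') (at a)"
  shows "r' p \<bullet> g a + r a \<bullet> g' p = l' p * (r a \<bullet> v) + l a * (r' p \<bullet> v)"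
proof -
  have "((\<lambda>u. r u \<bullet> g u) has_derivative (\<lambda>p. r a \<bullet> g' p + r' p \<bullet> g a)) (at a)"
    by (rule has_derivative_inner[OF r g])
  moreover have "((\<lambda>u. l u * (r u \<bullet> v)) has_derivative
      (\<lambda>p. l a * (r' p \<bullet> v) + l' p * (r a \<bullet> v))) (at a)"
    by (rule has_derivative_mult[OF l has_derivative_inner_left[OF r]])
  ultimately have "(\<lambda>p. r a \<bullet> g' p + r' p \<bullet> g a) = (\<lambda>p. l a * (r' p \<bullet> v) + l' p * (r a \<bullet> v))"
    unfolding rel by (rule has_derivative_unique)
  from fun_cong[OF this, of p] show ?thesis by linarith
qed

text \<open>
  Each projector \<open>F\<^sub>k\<close> acts on \<open>q0 (x - t s\<^sub>k) = u - t s\<^sub>k v + O(t\<^sup>2)\<close> with \<open>s\<^sub>k = (lam i u + lam k u) / 2\<close>.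
  Summing over \<open>k\<close>, \<open>\<Sum> F\<^sub>k\<close> is the identity and \<open>\<Sum> s\<^sub>k F\<^sub>k\<close> is the mean of \<open>lam i u\<close> and the Jacobian.
\<close>

lemma predictor_expansion:
  fixes R :: "real ^ 'm::finite \<Rightarrow> real ^ 'm ^ 'm"
  assumes inv: "invertible (R (q0 x))"
    and q0: "vanishes 2 UNIV x (\<lambda>y. q0 y - q0 x - (y - x) *\<^sub>R v)"
  shows "vanishes 2 S 0 (\<lambda>t. predictor R lam q0 t x i - q0 x - t *\<^sub>R (- (1 / 2) *\<^sub>R
    (lam i (q0 x) *\<^sub>R v + (matrix_inv (R (q0 x)) ** diagonal (\<lambda>k. lam k (q0 x)) ** R (q0 x)) *v v)))"
proof -
  let ?u = "q0 x"
  let ?J = "matrix_inv (R ?u) ** diagonal (\<lambda>k. lam k ?u) ** R ?u"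
  let ?F = "\<lambda>k. eigen_proj R k ?u"
  let ?s = "\<lambda>k. (lam i ?u + lam k ?u) / 2"
  have pred: "predictor R lam q0 t x i = (\<Sum>k\<in>UNIV. ?F k *v q0 (x - t * ?s k))" for t
    by (simp add: predictor_def vec_eq_iff matrix_vector_mult_def)
  have one: "(\<Sum>k\<in>UNIV. ?F k *v z) = z" for z
  proof -
    have "diagonal (\<lambda>k. 1) *v y = y" for y :: "real ^ 'm"
      by (simp add: vec_eq_iff diagonal_mult_vec)
    then show ?thesis
      using eigen_proj_spectral_sum[of "\<lambda>k. 1" R ?u z] by (simp add: matrix_inv_mult_vec[OF inv])
  qed
  have J: "(\<Sum>k\<in>UNIV. lam k ?u *\<^sub>R (?F k *v z)) = ?J *v z" for z
    using eigen_proj_spectral_sum[of "\<lambda>k. lam k ?u" R ?u z]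
    by (simp add: matrix_vector_mul_assoc matrix_mul_assoc)
  have speeds: "(\<Sum>k\<in>UNIV. ?s k *\<^sub>R (?F k *v v)) = (1 / 2) *\<^sub>R (lam i ?u *\<^sub>R v + ?J *v v)"
  proof -
    have "(\<Sum>k\<in>UNIV. ?s k *\<^sub>R (?F k *v v)) =
        (\<Sum>k\<in>UNIV. (1 / 2) *\<^sub>R (lam i ?u *\<^sub>R (?F k *v v) + lam k ?u *\<^sub>R (?F k *v v)))"
      by (intro sum.cong refl) (simp add: scaleR_add_left[symmetric])
    also have "\<dots> = (1 / 2) *\<^sub>R (lam i ?u *\<^sub>R (\<Sum>k\<in>UNIV. ?F k *v v) + (\<Sum>k\<in>UNIV. lam k ?u *\<^sub>R (?F k *v v)))"
      by (simp only: scaleR_sum_right[symmetric] sum.distrib)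
    finally show ?thesis by (simp only: one J)
  qed
  have "vanishes 2 S 0 (\<lambda>t. \<Sum>k\<in>UNIV. ?F k *v (q0 (x - t * ?s k) - ?u - ((x - t * ?s k) - x) *\<^sub>R v))"
  proof (intro vanishes_sum)
    fix k
    have "vanishes 1 S 0 (\<lambda>t. x - t * ?s k - x)"
      using vanishes_power_scaleR[of 1 S "- ?s k"] by simp
    from vanishes_compose[OF q0 this]
    show "vanishes 2 S 0 (\<lambda>t. ?F k *v (q0 (x - t * ?s k) - ?u - ((x - t * ?s k) - x) *\<^sub>R v))"
      by (rule vanishes_bounded_linear[OF matrix_vector_mul_bounded_linear])
  qed
  then show ?thesis
  proof (rule vanishes_cong)
    fix t
    have "(\<Sum>k\<in>UNIV. ?F k *v (q0 (x - t * ?s k) - ?u - ((x - t * ?s k) - x) *\<^sub>R v)) =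
        (\<Sum>k\<in>UNIV. ?F k *v q0 (x - t * ?s k) - ?F k *v ?u + t *\<^sub>R (?s k *\<^sub>R (?F k *v v)))"
      by (intro sum.cong refl)
         (simp add: matrix_vector_mult_diff_distrib matrix_vector_right_distrib matrix_vector_mult_scaleR)
    also have "\<dots> = (\<Sum>k\<in>UNIV. ?F k *v q0 (x - t * ?s k)) - (\<Sum>k\<in>UNIV. ?F k *v ?u)
        + t *\<^sub>R (\<Sum>k\<in>UNIV. ?s k *\<^sub>R (?F k *v v))"
      by (simp only: sum.distrib sum_subtractf scaleR_sum_right)
    also have "\<dots> = predictor R lam q0 t x i - ?u + t *\<^sub>R ((1 / 2) *\<^sub>R (lam i ?u *\<^sub>R v + ?J *v v))"
      by (simp only: pred one speeds)
    finally show "(\<Sum>k\<in>UNIV. ?F k *v (q0 (x - t * ?s k) - ?u - ((x - t * ?s k) - x) *\<^sub>R v)) =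
        predictor R lam q0 t x i - ?u - t *\<^sub>R (- (1 / 2) *\<^sub>R (lam i ?u *\<^sub>R v + ?J *v v))"
      by simp
  qed
qed

text \<open>
  The displacement is \<open>- (l t) t = - l0 t - \<mu> t\<^sup>2 + O(t\<^sup>3)\<close>, and the correction \<open>\<mu>\<close> of the speed meets
  only \<open>v\<close>, while the quadratic Taylor term sees \<open>l0\<close> alone.
\<close>

lemma characteristic_foot_expansion:
  fixes q0 :: "real \<Rightarrow> 'b::real_normed_vector"
  assumes q0: "vanishes 3 UNIV x (\<lambda>y. q0 y - q0 x - (y - x) *\<^sub>R v - ((y - x)\<^sup>2 / 2) *\<^sub>R w)"
    and l: "vanishes 2 S 0 (\<lambda>t. l t - l0 - t *\<^sub>R \<mu>)"
  shows "vanishes 3 S 0 (\<lambda>t. q0 (x - l t * t) - q0 x + t *\<^sub>R (l0 *\<^sub>R v)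
    - t\<^sup>2 *\<^sub>R ((l0\<^sup>2 / 2) *\<^sub>R w - \<mu> *\<^sub>R v))"
proof -
  have id: "vanishes 1 S (0::real) (\<lambda>t. t)" using vanishes_power[of 1 S] by simp
  have l1: "vanishes 1 S 0 (\<lambda>t. l t - l0)"
    using vanishes_add[OF vanishes_mono[OF l] vanishes_power_scaleR[of 1 S \<mu>]] by simp
  have l_bounded: "vanishes 0 S 0 l"
    using vanishes_add[OF vanishes_mono[OF l1] vanishes_const[of S 0 l0]] by simp
  have "vanishes 1 S 0 (\<lambda>t. l t * t)"
    using vanishes_bilinear[OF bounded_bilinear_mult l_bounded id] by simp
  then have "vanishes 1 S 0 (\<lambda>t. x - l t * t - x)"
    using vanishes_minus by fastforce
  note remainder = vanishes_compose[OF q0 this]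
  have "vanishes (2 + 1) S 0 (\<lambda>t. (l t - l0 - t *\<^sub>R \<mu>) * t)"
    by (rule vanishes_bilinear[OF bounded_bilinear_mult l id])
  from vanishes_bounded_linear[OF bounded_linear_scaleR_left this, of v]
  have linear_term: "vanishes 3 S 0 (\<lambda>t. ((l t - l0 - t *\<^sub>R \<mu>) * t) *\<^sub>R v)" by simp
  have "vanishes 0 S 0 (\<lambda>t. l t + l0)"
    by (rule vanishes_add[OF l_bounded vanishes_const])
  from vanishes_bilinear[OF bounded_bilinear_mult vanishes_bilinear[OF bounded_bilinear_mult l1 this]
      vanishes_power[of 2 S]]
  have "vanishes 3 S 0 (\<lambda>t. (l t - l0) * (l t + l0) * t\<^sup>2)" by (simp add: numeral_3_eq_3 numeral_2_eq_2)
  from vanishes_bounded_linear[OF bounded_linear_scaleR_left this, of "(1 / 2) *\<^sub>R w"]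
  have quadratic_term: "vanishes 3 S 0 (\<lambda>t. ((l t - l0) * (l t + l0) * t\<^sup>2) *\<^sub>R ((1 / 2) *\<^sub>R w))" .
  show ?thesis
  proof (rule vanishes_cong[OF vanishes_add[OF vanishes_diff[OF remainder linear_term] quadratic_term]])
    fix t
    have "l t * t - l0 * t - (l t - l0 - t * \<mu>) * t - t\<^sup>2 * \<mu> = 0" by (simp add: algebra_simps power2_eq_square)
    then have v: "(l t * t) *\<^sub>R v = (l0 * t) *\<^sub>R v + ((l t - l0 - t * \<mu>) * t) *\<^sub>R v + (t\<^sup>2 * \<mu>) *\<^sub>R v"
      unfolding scaleR_add_left[symmetric] by (intro arg_cong[where f = "\<lambda>c. c *\<^sub>R v"]) linarith
    have "(l t * t)\<^sup>2 = (l t - l0) * (l t + l0) * t\<^sup>2 + t\<^sup>2 * l0\<^sup>2"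
      by (simp add: algebra_simps power2_eq_square)
    then have w: "((l t * t)\<^sup>2 / 2) *\<^sub>R w = ((l t - l0) * (l t + l0) * t\<^sup>2 / 2) *\<^sub>R w + (t\<^sup>2 * (l0\<^sup>2 / 2)) *\<^sub>R w"
      unfolding scaleR_add_left[symmetric] by (intro arg_cong[where f = "\<lambda>c. c *\<^sub>R w"]) linarith
    show "q0 (x - l t * t) - q0 x - (x - l t * t - x) *\<^sub>R v - ((x - l t * t - x)\<^sup>2 / 2) *\<^sub>R w
        - ((l t - l0 - t *\<^sub>R \<mu>) * t) *\<^sub>R v + ((l t - l0) * (l t + l0) * t\<^sup>2) *\<^sub>R ((1 / 2) *\<^sub>R w)
        = q0 (x - l t * t) - q0 x + t *\<^sub>R (l0 *\<^sub>R v) - t\<^sup>2 *\<^sub>R ((l0\<^sup>2 / 2) *\<^sub>R w - \<mu> *\<^sub>R v)"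
      using v w by (simp add: scaleR_diff_right mult.commute)
  qed
qed

text \<open>
  The hypotheses in \<open>zero\<close> say that the coefficients of \<open>t\<close> and \<open>t\<^sup>2\<close> in the product vanish. As \<open>b\<close> has
  no constant term, it is enough to know \<open>a\<close> up to \<open>O(t\<^sup>2)\<close>.
\<close>

lemma inner_vanishes_order3:
  fixes a b :: "real \<Rightarrow> 'b::real_inner"
  assumes a: "vanishes 2 S 0 (\<lambda>t. a t - r - t *\<^sub>R r')"
    and b: "vanishes 3 S 0 (\<lambda>t. b t - t *\<^sub>R b1 - t\<^sup>2 *\<^sub>R b2)"
    and zero: "r \<bullet> b1 = 0" "r \<bullet> b2 + r' \<bullet> b1 = 0"
  shows "vanishes 3 S 0 (\<lambda>t. a t \<bullet> b t)"
proof -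
  have "vanishes 1 S 0 (\<lambda>t. t ^ 1 *\<^sub>R b1 + t *\<^sub>R (t ^ 1 *\<^sub>R b2))"
    using vanishes_add[OF vanishes_power_scaleR[of 1 S b1]
        vanishes_mono[OF vanishes_power_scaleR[of 2 S b2], of 1]]
    by (simp add: power2_eq_square)
  from vanishes_add[OF vanishes_mono[OF b, of 1] this]
  have "vanishes 1 S 0 b" by (simp add: power2_eq_square)
  from vanishes_bilinear[OF bounded_bilinear_inner a this]
  have t1: "vanishes 3 S 0 (\<lambda>t. (a t - r - t *\<^sub>R r') \<bullet> b t)" by simp
  have "vanishes 0 S 0 (\<lambda>t. r + t ^ 1 *\<^sub>R r')"
    by (rule vanishes_add[OF vanishes_const vanishes_mono[OF vanishes_power_scaleR[of 1 S r']]]) simp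
  from vanishes_bilinear[OF bounded_bilinear_inner this b]
  have t2: "vanishes 3 S 0 (\<lambda>t. (r + t *\<^sub>R r') \<bullet> (b t - t *\<^sub>R b1 - t\<^sup>2 *\<^sub>R b2))" by simp
  have t3: "vanishes 3 S 0 (\<lambda>t. t ^ 3 *\<^sub>R (r' \<bullet> b2))" by (rule vanishes_power_scaleR)
  show ?thesis
  proof (rule vanishes_cong[OF vanishes_add[OF vanishes_add[OF t1 t2] t3]])
    fix t
    have "r' \<bullet> b1 = - (r \<bullet> b2)" using zero(2) by linarith
    then show "(a t - r - t *\<^sub>R r') \<bullet> b t + (r + t *\<^sub>R r') \<bullet> (b t - t *\<^sub>R b1 - t\<^sup>2 *\<^sub>R b2)
        + t ^ 3 *\<^sub>R (r' \<bullet> b2) = a t \<bullet> b t"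
      using zero(1) by (simp add: inner_diff_left inner_diff_right inner_add_left algebra_simps
          power2_eq_square power3_eq_cube)
  qed
qed

text \<open>
  From \<open>z = (matrix_inv A0) (A z) - (matrix_inv A0) ((A - A0) z)\<close>: as soon as \<open>A - A0\<close> is small, the last term is at most
  \<open>norm z / 2\<close> and can be absorbed. The bound yields both invertibility of \<open>A t\<close> and control of its
  inverse that is uniform in \<open>t\<close>.
\<close>

lemma eventually_uniformly_injective:
  fixes A :: "'t \<Rightarrow> real ^ 'm::finite ^ 'm"
  assumes A: "(A \<longlongrightarrow> A0) F" and inv: "invertible A0"
  shows "\<exists>K. \<forall>\<^sub>F t in F. \<forall>z. norm z \<le> K * norm (A t *v z)"
proof -
  have "bilinear ((*v) :: real ^ 'm ^ 'm \<Rightarrow> real ^ 'm \<Rightarrow> real ^ 'm)"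
    unfolding bilinear_def
    by (auto intro!: linearI simp: matrix_vector_mult_add_rdistrib matrix_vector_right_distrib
        matrix_vector_mult_scaleR scaleR_matrix_vector_assoc[symmetric])
  then have "bounded_bilinear ((*v) :: real ^ 'm ^ 'm \<Rightarrow> real ^ 'm \<Rightarrow> real ^ 'm)"
    by (simp add: bilinear_conv_bounded_bilinear)
  from bounded_bilinear.nonneg_bounded[OF this]
  obtain C where C: "C \<ge> 0" "\<And>M z. norm (M *v z) \<le> norm (M :: real ^ 'm ^ 'm) * norm z * C"
    by blast
  let ?B = "matrix_inv A0"
  let ?D = "norm ?B * C"
  have D: "?D \<ge> 0" using C(1) by simp
  have "((\<lambda>t. ?D * (norm (A t - A0) * C)) \<longlongrightarrow> ?D * (norm (A0 - A0) * C)) F"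
    by (intro tendsto_intros A)
  then have "\<forall>\<^sub>F t in F. ?D * (norm (A t - A0) * C) < 1 / 2"
    by (rule order_tendstoD) simp
  then have "\<forall>\<^sub>F t in F. \<forall>z. norm z \<le> (2 * ?D) * norm (A t *v z)"
  proof eventually_elim
    case (elim t)
    show ?case
    proof
      fix z :: "real ^ 'm"
      have "z = ?B *v (A0 *v z)" by (simp add: matrix_inv_mult_vec[OF inv])
      also have "A0 *v z = A t *v z - (A t - A0) *v z"
        by (simp add: matrix_vector_mult_diff_rdistrib)
      finally have "norm z = norm (?B *v (A t *v z - (A t - A0) *v z))" by simp
      also have "\<dots> \<le> ?D * norm (A t *v z - (A t - A0) *v z)"
        using C(2)[of ?B "A t *v z - (A t - A0) *v z"] by (simp only: mult_ac)
      also have "\<dots> \<le> ?D * (norm (A t *v z) + norm ((A t - A0) *v z))"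
        by (intro mult_left_mono norm_triangle_ineq4 D)
      also have "\<dots> \<le> ?D * (norm (A t *v z) + norm (A t - A0) * norm z * C)"
        by (intro mult_left_mono add_left_mono C(2) D)
      also have "\<dots> = ?D * norm (A t *v z) + (?D * (norm (A t - A0) * C)) * norm z"
        by (simp add: algebra_simps)
      also have "\<dots> \<le> ?D * norm (A t *v z) + (1 / 2) * norm z"
        using elim by (intro add_left_mono mult_right_mono) auto
      finally show "norm z \<le> (2 * ?D) * norm (A t *v z)" by linarith
    qed
  qed
  then show ?thesis by blast
qed

section \<open>Order of the approximate solution operator\<close>

text \<open>
  The cancellation at the heart of the scheme. Both factors of the residual are expanded, the first to
  \<open>r + t r'\<close> and the second to \<open>t b1 + t\<^sup>2 b2\<close>, and the coefficients of \<open>t\<close> and \<open>t\<^sup>2\<close> of their inner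
  product are shown to be zero.
\<close>

lemma row_residual_vanishes:
  fixes f :: "real ^ 'm::finite \<Rightarrow> real ^ 'm"
    and R :: "real ^ 'm \<Rightarrow> real ^ 'm ^ 'm"
    and lam :: "'m \<Rightarrow> real ^ 'm \<Rightarrow> real"
  assumes f_smooth: "smooth_on UNIV f"
    and R_smooth: "smooth_on UNIV R"
    and lam_smooth: "smooth_on UNIV (lam i)"
    and R_invertible: "\<And>u. invertible (R u)"
    and jacobian_f: "\<And>u. jacobian f (at u) = matrix_inv (R u) ** diagonal (\<lambda>i. lam i u) ** R u"
    and q0_smooth: "smooth_on UNIV q0"
    and T_pos: "T > 0"
    and q_solution: "smooth_solution f q0 T q"
  shows "vanishes 1 {0..<T} 0 (\<lambda>t. R_star R lam q0 t x $ i - R (q0 x) $ i)"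
    and "vanishes 3 {0..<T} 0 (\<lambda>t. R_star R lam q0 t x $ i \<bullet> (q t x - q0 (x - lam_star R lam q0 t x i * t)))"
proof -
  let ?I = "{0..<T}"
  let ?u = "q0 x"
  obtain q1 q2 where q1: "\<And>y. (q0 has_vector_derivative q1 y) (at y)"
    and q2: "\<And>y. (q1 has_vector_derivative q2 y) (at y)"
    and q2_diff: "\<And>y. q2 differentiable (at y)"
    by (rule smooth_on_real_derivatives[OF q0_smooth]) (rule that)
  obtain f' where f': "\<And>u. (f has_derivative f' u) (at u)"
    and f'_diff: "\<And>u v. (\<lambda>u. f' u v) differentiable (at u)"
    by (rule smooth_on_UNIV_derivatives[OF f_smooth]) (rule that)
  obtain R' where R': "\<And>u. (R has_derivative R' u) (at u)"
    and R'_diff: "\<And>u v. (\<lambda>u. R' u v) differentiable (at u)"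
    by (rule smooth_on_UNIV_derivatives[OF R_smooth]) (rule that)
  obtain l' where l': "\<And>u. (lam i has_derivative l' u) (at u)"
    and l'_diff: "\<And>u v. (\<lambda>u. l' u v) differentiable (at u)"
    by (rule smooth_on_UNIV_derivatives[OF lam_smooth]) (rule that)
  have "\<forall>v. \<exists>D. ((\<lambda>u. f' u v) has_derivative D) (at ?u)"
    using f'_diff unfolding differentiable_def by blast
  from choice[OF this] obtain G where G: "\<And>v. ((\<lambda>u. f' u v) has_derivative G v) (at ?u)" by blast
  have lin_G: "linear (G v)" for v by (rule has_derivative_linear[OF G])
  have f'_eq: "f' u z = (matrix_inv (R u) ** diagonal (\<lambda>i. lam i u) ** R u) *v z" for u z
  proof -
    have "f differentiable (at u)" using f' unfolding differentiable_def by blast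
    then have "(f has_derivative (\<lambda>h. jacobian f (at u) *v h)) (at u)"
      by (simp only: jacobian_works)
    from has_derivative_unique[OF f' this] show ?thesis by (simp add: jacobian_f)
  qed
  have eigen: "R u $ i \<bullet> f' u z = lam i u * (R u $ i \<bullet> z)" for u z
    unfolding f'_eq by (rule row_eigenvector) (rule R_invertible)
  define v where "v = q1 x"
  define w where "w = q2 x"
  define r where "r = R ?u $ i"
  define l where "l = lam i ?u"
  \<comment> \<open>\<open>p\<close>: velocity of the predictor; \<open>r'\<close>, \<open>\<mu>\<close>: the resulting first-order changes of row and speed\<close>
  define p where "p = - (1 / 2) *\<^sub>R (l *\<^sub>R v + f' ?u v)"
  define r' where "r' = R' ?u p $ i"
  define \<mu> where "\<mu> = l' ?u p"
  have taylor: "vanishes 3 UNIV x (\<lambda>y. q0 y - q0 x - (y - x) *\<^sub>R v - ((y - x)\<^sup>2 / 2) *\<^sub>R w)"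
    unfolding v_def w_def using q1 q2 q2_diff by (intro vanishes_taylor2) auto
  have "vanishes 2 UNIV x (\<lambda>y. q0 y - q0 x - (y - x) *\<^sub>R v)"
    unfolding v_def
  proof (rule vanishes_taylor1[where f' = "\<lambda>y h. h *\<^sub>R q1 y"])
    show "(q0 has_derivative (\<lambda>h. h *\<^sub>R q1 y)) (at y within UNIV)" for y
      using q1[of y] by (simp add: has_vector_derivative_def)
    have "q1 differentiable (at x within UNIV)"
      using q2[of x] unfolding has_vector_derivative_def differentiable_def by auto
    then show "(\<lambda>y. b *\<^sub>R q1 y) differentiable (at x within UNIV)" for b
      by (intro differentiable_scaleR differentiable_const)
  qed auto
  from predictor_expansion[where R = R and lam = lam and i = i and S = ?I, OF R_invertible this]
  have pred: "vanishes 2 ?I 0 (\<lambda>t. predictor R lam q0 t x i - ?u - t *\<^sub>R p)"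
    by (simp only: f'_eq[symmetric] p_def l_def)
  have "vanishes 2 UNIV ?u (\<lambda>u. R u - R ?u - R' ?u (u - ?u))"
    using R' R'_diff by (intro vanishes_taylor1) auto
  from vanishes_bounded_linear[OF bounded_linear_vec_nth
      vanishes_curve_expansion[OF this has_derivative_bounded_linear[OF R'] pred], of i]
  have row: "vanishes 2 ?I 0 (\<lambda>t. R_star R lam q0 t x $ i - r - t *\<^sub>R r')"
    by (simp add: R_star_def r_def r'_def)
  have "vanishes 2 UNIV ?u (\<lambda>u. lam i u - lam i ?u - l' ?u (u - ?u))"
    using l' l'_diff by (intro vanishes_taylor1) auto
  from vanishes_curve_expansion[OF this has_derivative_bounded_linear[OF l'] pred]
  have speed: "vanishes 2 ?I 0 (\<lambda>t. lam_star R lam q0 t x i - l - t *\<^sub>R \<mu>)"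
    by (simp only: lam_star_def l_def \<mu>_def)
  show "vanishes 1 ?I 0 (\<lambda>t. R_star R lam q0 t x $ i - R (q0 x) $ i)"
    using vanishes_add[OF vanishes_mono[OF row] vanishes_power_scaleR[of 1 ?I r']]
    by (simp add: r_def)
  let ?q2 = "f' ?u (f' ?u w + G v v) + G v (f' ?u v)"
  let ?b1 = "l *\<^sub>R v - f' ?u v"
  let ?b2 = "(1 / 2) *\<^sub>R ?q2 - ((l\<^sup>2 / 2) *\<^sub>R w - \<mu> *\<^sub>R v)"
  have "vanishes 3 ?I 0 (\<lambda>t. q t x - ?u + t *\<^sub>R f' ?u v - (t\<^sup>2 / 2) *\<^sub>R ?q2)"
    unfolding v_def w_def by (rule solution_time_expansion[OF f' G q1 q2 T_pos q_solution])
  from vanishes_diff[OF this characteristic_foot_expansion[OF taylor speed]]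
  have diff: "vanishes 3 ?I 0 (\<lambda>t. (q t x - q0 (x - lam_star R lam q0 t x i * t)) - t *\<^sub>R ?b1 - t\<^sup>2 *\<^sub>R ?b2)"
  proof (rule vanishes_cong)
    fix t
    show "q t x - ?u + t *\<^sub>R f' ?u v - (t\<^sup>2 / 2) *\<^sub>R ?q2 - (q0 (x - lam_star R lam q0 t x i * t) - ?u
        + t *\<^sub>R (l *\<^sub>R v) - t\<^sup>2 *\<^sub>R ((l\<^sup>2 / 2) *\<^sub>R w - \<mu> *\<^sub>R v))
      = (q t x - q0 (x - lam_star R lam q0 t x i * t)) - t *\<^sub>R ?b1 - t\<^sup>2 *\<^sub>R ?b2"
      by (simp add: scaleR_diff_right)
  qed
  have eig: "r \<bullet> f' ?u z = l * (r \<bullet> z)" for z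
    unfolding r_def l_def by (rule eigen)
  have first: "r \<bullet> ?b1 = 0"
    by (simp add: inner_diff_right eig)
  have "r' \<bullet> f' ?u v + r \<bullet> G v p = \<mu> * (r \<bullet> v) + l * (r' \<bullet> v)"
    unfolding r_def r'_def l_def \<mu>_def
    by (rule row_eigenvector_derivative[where r = "\<lambda>u. R u $ i" and r' = "\<lambda>h. R' ?u h $ i"])
       (auto intro: eigen l' G bounded_linear.has_derivative[OF bounded_linear_vec_nth R'])
  moreover have "G v p = - (1 / 2) *\<^sub>R (l *\<^sub>R G v v + G v (f' ?u v))"
    unfolding p_def by (simp only: linear_scale[OF lin_G] linear_add[OF lin_G])
  \<comment> \<open>\<open>w\<close> cancels since \<open>r \<bullet> f' (f' w) = l\<^sup>2 (r \<bullet> w)\<close>; what remains is \<open>r \<bullet> G v p\<close> plus its negative\<close>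
  ultimately have second: "r \<bullet> ?b2 + r' \<bullet> ?b1 = 0"
    by (simp add: inner_diff_right inner_add_right eig algebra_simps power2_eq_square)
  show "vanishes 3 ?I 0 (\<lambda>t. R_star R lam q0 t x $ i \<bullet> (q t x - q0 (x - lam_star R lam q0 t x i * t)))"
    by (rule inner_vanishes_order3[OF row diff first second])
qed

theorem theorem4p1:
  fixes f :: "real ^ 'm::finite \<Rightarrow> real ^ 'm"
    and R :: "real ^ 'm \<Rightarrow> real ^ 'm ^ 'm"
    and lam :: "'m \<Rightarrow> real ^ 'm \<Rightarrow> real"
    and q0 :: "real \<Rightarrow> real ^ 'm"
    and q :: "real \<Rightarrow> real \<Rightarrow> real ^ 'm"
    and T x :: real
  assumes f_smooth: "smooth_on UNIV f"
    and R_smooth: "smooth_on UNIV R"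
    and lam_smooth: "\<And>i. smooth_on UNIV (lam i)"
    and R_invertible: "\<And>u. invertible (R u)"
    and jacobian_f: "\<And>u. jacobian f (at u) = matrix_inv (R u) ** diagonal (\<lambda>i. lam i u) ** R u"
    and q0_smooth: "smooth_on UNIV q0"
    and T_pos: "T > 0"
    and q_solution: "smooth_solution f q0 T q"
  shows "(\<forall>\<^sub>F t in at_right 0. invertible (R_star R lam q0 t x)) \<and>
    (\<forall>l. (\<lambda>t. approx_solution R lam q0 t x $ l - q t x $ l) \<in> O[at_right 0](\<lambda>t. t ^ 3))"
proof -
  let ?A = "\<lambda>t. R_star R lam q0 t x"
  let ?e = "\<lambda>t i. ?A t $ i \<bullet> (q t x - q0 (x - lam_star R lam q0 t x i * t))"
  note row = row_residual_vanishes[OF f_smooth R_smooth lam_smooth R_invertible jacobian_f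
      q0_smooth T_pos q_solution, of x]
  have "(?A \<longlongrightarrow> R (q0 x)) (at_right 0)"
    by (intro vec_tendstoI vanishes_imp_tendsto_at_right[OF row(1) T_pos])
  from eventually_uniformly_injective[OF this R_invertible]
  obtain K where K: "\<forall>\<^sub>F t in at_right 0. \<forall>z. norm z \<le> K * norm (?A t *v z)" by blast
  have invertible: "invertible (?A t)" if "\<forall>z. norm z \<le> K * norm (?A t *v z)" for t
  proof -
    have "z = 0" if "?A t *v z = 0" for z
      using \<open>\<forall>z. norm z \<le> K * norm (?A t *v z)\<close>[rule_format, of z] that by simp
    then show ?thesis
      unfolding invertible_left_inverse matrix_left_invertible_ker by blast
  qed
  have "\<forall>\<^sub>F t in at_right 0. invertible (?A t)"
    using K by eventually_elim (rule invertible)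
  moreover have "(\<lambda>t. approx_solution R lam q0 t x $ j - q t x $ j) \<in> O[at_right 0](\<lambda>t. t ^ 3)" for j
  proof -
    have "vanishes 3 {0..<T} 0 (\<lambda>t. \<bar>?e t i\<bar>)" for i
      using row(2)[of i] unfolding vanishes_def by simp
    then have "vanishes 3 {0..<T} 0 (\<lambda>t. \<Sum>i\<in>UNIV. \<bar>?e t i\<bar>)"
      by (intro vanishes_sum)
    then have residual: "(\<lambda>t. \<Sum>i\<in>UNIV. \<bar>?e t i\<bar>) \<in> O[at_right 0](\<lambda>t. t ^ 3)"
      by (rule vanishes_imp_bigo_at_right[OF _ T_pos])
    have "\<forall>\<^sub>F t in at_right 0. norm (approx_solution R lam q0 t x $ j - q t x $ j) \<le>
        \<bar>K\<bar> * norm (\<Sum>i\<in>UNIV. \<bar>?e t i\<bar>)"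
      using K
    proof eventually_elim
      case (elim t)
      let ?y = "\<chi> i. ?A t $ i \<bullet> q0 (x - lam_star R lam q0 t x i * t)"
      let ?z = "approx_solution R lam q0 t x - q t x"
      have "approx_solution R lam q0 t x = matrix_inv (?A t) *v ?y"
        by (simp add: approx_solution_def vec_eq_iff matrix_vector_mult_def inner_vec_def)
      then have "?A t *v approx_solution R lam q0 t x = ?y"
        by (simp add: matrix_inv_mult_vec[OF invertible[OF elim]])
      \<comment> \<open>applying \<open>R\<^sup>*\<close> to the error turns its components into the row residuals\<close>
      then have "(?A t *v ?z) $ i = - ?e t i" for i
        by (simp add: matrix_vector_mult_diff_distrib matrix_vector_mul_component inner_diff_right)
      then have "norm (?A t *v ?z) \<le> (\<Sum>i\<in>UNIV. \<bar>?e t i\<bar>)"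
        using norm_le_l1_cart[of "?A t *v ?z"] by simp
      then have *: "\<bar>K\<bar> * norm (?A t *v ?z) \<le> \<bar>K\<bar> * (\<Sum>i\<in>UNIV. \<bar>?e t i\<bar>)"
        by (rule mult_left_mono) simp
      have "\<bar>?z $ j\<bar> \<le> norm ?z" by (rule component_le_norm_cart)
      also have "\<dots> \<le> K * norm (?A t *v ?z)" using elim by blast
      also have "\<dots> \<le> \<bar>K\<bar> * norm (?A t *v ?z)" by (intro mult_right_mono) auto
      also note *
      also have "(\<Sum>i\<in>UNIV. \<bar>?e t i\<bar>) = norm (\<Sum>i\<in>UNIV. \<bar>?e t i\<bar>)"
        by (simp add: sum_nonneg)
      finally show ?case by simp
    qed
    then have "(\<lambda>t. approx_solution R lam q0 t x $ j - q t x $ j) \<in>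
        O[at_right 0](\<lambda>t. \<Sum>i\<in>UNIV. \<bar>?e t i\<bar>)"
      by (rule bigoI)
    then show ?thesis using residual by (rule landau_o.big_trans)
  qed
  ultimately show ?thesis by blast
qed

end
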